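(* Let $n$ and $k$ be integers with $n>k>1$, and let $B_{n-k}$ be the Boolean lattice of height $n-k$. Then $\mathrm{Poset}(\mathrm{PF}_{n,k})$ is isomorphic, as a poset, to the direct product $\mathrm{Poset}(\mathrm{PF}_{k,k})\times B_{n-k}$.
   Context: The Boolean lattice $B_m$ of height $m$ is the lattice of subsets of an $m$-element set ordered by inclusion. Write $[n]=\{1,\dots,n\}$. A parking function of length $n$ is an $n$-tuple $(a_1,\dots,a_n)$ of positive integers whose weakly increasing rearrangement $b_1\le\dots\le b_n$ satisfies $b_i\le i$ for all $i$; $\mathrm{PF}_n$ is the set of these. For $1<k\le n$, $\mathrm{PF}_{n,k}$ is the set of $a\in\mathrm{PF}_n$ such that $k$ is not an entry of $a$ but each of $k+1,\dots,n$ is an entry of $a$. $\mathrm{NC}_m$ is the lattice of noncrossing partitions of $[m]$ (partitions for which, placing $1,\dots,m$ in clockwise order on a circle, the convex hulls of the blocks are pairwise disjoint), ordered by refinement, with the finer partition being smaller. Each covering relation $\sigma<\tau$ in $\mathrm{NC}_{n+1}$ merges two blocks $B_1,B_2$ of $\sigma$ into one block $B=B_1\cup B_2$ of $\tau$; name them so that $\min B\in B_1$, and label the covering relation by the largest element of $B_1$ that is less than every element of $B_2$. Reading the labels of a maximal chain of $\mathrm{NC}_{n+1}$ from bottom to top gives a parking function of length $n$, and this is a (known) bijection from maximal chains of $\mathrm{NC}_{n+1}$ to $\mathrm{PF}_n$. $\mathrm{Poset}(\mathrm{PF}_{n,k})$ is the poset whose Hasse diagram is the union of the maximal chains of $\mathrm{NC}_{n+1}$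 corresponding to elements of $\mathrm{PF}_{n,k}$: its elements are the noncrossing partitions lying on at least one of these chains, and its order is the reflexive-transitive closure of the covering relations occurring in these chains (it need not be an induced subposet of $\mathrm{NC}_{n+1}$). *)

theory Defs
  imports "HOL-Analysis.Analysis" "HOL-Library.Disjoint_Sets"
begin

text \<open>
  Posets are represented, as in \<^theory>\<open>HOL.Order_Relation\<close>, by their (reflexive) order relation
  \<open>r\<close>; the underlying set is \<open>Field r\<close>.
\<close>

definition poset_isomorphic :: "'a rel \<Rightarrow> 'b rel \<Rightarrow> bool" where
  "poset_isomorphic r s \<longleftrightarrow> Partial_order r \<and> Partial_order s \<and>
     (\<exists>f. bij_betw f (Field r) (Field s) \<and>
          (\<forall>x\<in>Field r. \<forall>y\<in>Field r. (x, y) \<in> r \<longleftrightarrow> (f x, f y) \<in> s))"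

definition poset_prod :: "'a rel \<Rightarrow> 'b rel \<Rightarrow> ('a \<times> 'b) rel" where
  "poset_prod r s = {((a, b), (c, d)). (a, c) \<in> r \<and> (b, d) \<in> s}"

definition boolean_lattice :: "nat \<Rightarrow> nat set rel" where
  "boolean_lattice m = {(S, T). S \<subseteq> T \<and> T \<subseteq> {1..m}}"


definition parking_functions :: "nat \<Rightarrow> nat list set" where
  "parking_functions n =
     {a. length a = n \<and> (\<forall>x\<in>set a. 0 < x) \<and> (\<forall>i<n. sort a ! i \<le> Suc i)}"

definition PF :: "nat \<Rightarrow> nat \<Rightarrow> nat list set" where
  "PF n k = {a \<in> parking_functions n. k \<notin> set a \<and> {k+1..n} \<subseteq> set a}"


text \<open>The points \<open>1, \<dots>, m\<close> are placed clockwise on the unit circle of the complex plane.\<close>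

definition circle_point :: "nat \<Rightarrow> nat \<Rightarrow> complex" where
  "circle_point m i = cis (- (2 * pi * real i / real m))"

definition noncrossing :: "nat \<Rightarrow> nat set set \<Rightarrow> bool" where
  "noncrossing m P \<longleftrightarrow>
     pairwise (\<lambda>B C. disjnt (convex hull (circle_point m ` B)) (convex hull (circle_point m ` C))) P"

definition NC :: "nat \<Rightarrow> nat set set set" where
  "NC m = {P. partition_on {1..m} P \<and> noncrossing m P}"

text \<open>
  A maximal chain of \<open>NC m\<close>, listed from bottom to top.
\<close>

definition nc_maximal_chain :: "nat \<Rightarrow> nat set set list \<Rightarrow> bool" where
  "nc_maximal_chain m c \<longleftrightarrow>
     pred_on.maxchain (NC m) (refines {1..m}) (set c) \<and>
     distinct c \<and> sorted_wrt (refines {1..m}) c"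

definition merges :: "nat set set \<Rightarrow> nat set set \<Rightarrow> nat set \<Rightarrow> nat set \<Rightarrow> bool" where
  "merges \<sigma> \<tau> B1 B2 \<longleftrightarrow> B1 \<in> \<sigma> \<and> B2 \<in> \<sigma> \<and> B1 \<noteq> B2 \<and>
     \<tau> = insert (B1 \<union> B2) (\<sigma> - {B1, B2}) \<and> Min (B1 \<union> B2) \<in> B1"

text \<open>
  The description is meaningful only if \<open>\<tau>\<close> covers \<open>\<sigma>\<close> in some \<open>NC m\<close>, in which case the pair
  \<open>B1, B2\<close> exists and is unique.
\<close>

definition cover_label :: "nat set set \<Rightarrow> nat set set \<Rightarrow> nat" where
  "cover_label \<sigma> \<tau> =
     (THE l. \<exists>B1 B2. merges \<sigma> \<tau> B1 B2 \<and> l = Max {x \<in> B1. \<forall>y\<in>B2. x < y})"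

definition chain_labels :: "nat set set list \<Rightarrow> nat list" where
  "chain_labels c = map2 cover_label c (tl c)"


definition chains_of :: "nat \<Rightarrow> nat list set \<Rightarrow> nat set set list set" where
  "chains_of n X = {c. nc_maximal_chain (n + 1) c \<and> chain_labels c \<in> X}"

text \<open>
  Poset(X) for a set \<open>X\<close> of parking functions of length \<open>n\<close>. Since a chain is listed in increasing
  order, the covering relations occurring in it are its pairs of consecutive entries. The
  restriction only removes the reflexive pairs outside the underlying set.
\<close>

definition Poset :: "nat \<Rightarrow> nat list set \<Rightarrow> nat set set rel" where
  "Poset n X =
     Restr ((\<Union>c\<in>chains_of n X. set (zip c (tl c)))\<^sup>*) (\<Union>c\<in>chains_of n X. set c)"

end

theory Submission
  imports Defs
begin

text \<open>
  Along a maximal chain of \<open>NC (n + 1)\<close> each \<open>x\<close> in \<open>2, \<dots>, n + 1\<close> stops being the minimum of its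
  block exactly once, at a step whose label \<open>l x\<close> is less than \<open>x\<close>. If \<open>k + 1, \<dots>, n\<close> all occur as
  labels and \<open>k\<close> does not, descending induction gives \<open>l x = x - 1\<close> for \<open>x > k + 1\<close>, so the condition
  on the chain is a condition on its individual steps. Therefore \<open>Poset (PF n k)\<close> consists of the paths
  from bottom to top in a subgraph of the Hasse diagram, and in each of its partitions every point
  \<open>x > k + 1\<close> independently is either the minimum of its block or attached to \<open>x - 1\<close>: this
  choice for the last point splits off one factor \<open>{0 < 1}\<close> of the Boolean lattice at a time.
\<close>

section \<open>Noncrossing partitions and crossing points\<close>

text \<open>The order of \<open>Poset\<close> is generated by the covers inside the chains and need
  not be induced, so refinement alone does not decide comparability. Once the condition on a chain
  is local, allowed steps concatenate freely and the order is plain reachability between bottom and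
  top; this is the form that splits as a product. Locality comes from a squeeze. Since
  \<open>l x < x\<close>, the label n can only belong to n + 1; then n - 1 only to n, because n + 1
  is taken, and so on down to the label k + 1 at k + 2. All points beyond k + 1 thus carry labels
  above k, and avoiding k becomes a condition on the point k + 1 alone. The points up to k + 1 are
  therefore under the same condition as in \<open>PF k k\<close>, which explains the first factor.
  The convex hulls in the definition of noncrossing are unsuited to merging blocks or adding a
  point. They are traded for interleaving of four numbers, with areas of triangles inscribed in the
  circle deciding on which side of a chord a point lies.\<close>

definition cross :: "nat set \<Rightarrow> nat set \<Rightarrow> bool" where
  "cross A B \<longleftrightarrow> (\<exists>p\<in>A. \<exists>r\<in>A. \<exists>q\<in>B. \<exists>s\<in>B. q < r \<and> r < s \<and> (p < q \<or> s < p))"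

lemma crossI: "p \<in> A \<Longrightarrow> r \<in> A \<Longrightarrow> q \<in> B \<Longrightarrow> s \<in> B \<Longrightarrow> q < r \<Longrightarrow> r < s \<Longrightarrow> p < q \<or> s < p \<Longrightarrow> cross A B"
  unfolding cross_def by blast

text \<open>Interleaving is cyclic: the disjunction in \<open>cross\<close> allows the outer point
  on either end, so rotating the four points exchanges the two sets.\<close>

lemma cross_sym: "cross A B \<Longrightarrow> cross B A"
  unfolding cross_def by meson

lemma cross_mono: "cross A B \<Longrightarrow> A \<subseteq> A' \<Longrightarrow> B \<subseteq> B' \<Longrightarrow> cross A' B'"
  unfolding cross_def by blast

lemma cross_cases:
  assumes "cross A B"
  obtains a b c d where "a < b" "b < c" "c < d"
    "a \<in> A \<and> c \<in> A \<and> b \<in> B \<and> d \<in> B \<or> a \<in> B \<and> c \<in> B \<and> b \<in> A \<and> d \<in> A"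
  using assms unfolding cross_def by metis

section \<open>Signed areas, and when convex hulls of points on the circle meet\<close>

definition orient :: "complex \<Rightarrow> complex \<Rightarrow> complex \<Rightarrow> real" where
  "orient u v w = Im (cnj (v - u) * (w - u))"

text \<open>\<open>orient\<close> is twice the signed area of a triangle. For a triangle inscribed
  in the unit circle it factors into sines of half the angle differences, so its sign can be read
  off from the positions of the three points.\<close>

lemma orient_cis:
  "orient (cis a) (cis b) (cis c) = 4 * sin ((b - a) / 2) * sin ((c - b) / 2) * sin ((c - a) / 2)"
proof -
  define x y where "x = (b - a) / 2" and "y = (c - b) / 2"
  have s: "(c - a) / 2 = x + y" "b = a + 2 * x" "c = a + 2 * x + 2 * y"
    by (simp_all add: x_def y_def field_simps)
  have ca: "sin (c - a) = sin (2 * x + 2 * y)" "sin (b - a) = sin (2 * x)" "sin (c - b) = sin (2 * y)"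
    by (simp_all add: s)
  have "orient (cis a) (cis b) (cis c) = sin (b - a) + sin (c - b) - sin (c - a)"
    by (simp add: orient_def sin_diff algebra_simps)
  also have "\<dots> = sin (2 * x) + sin (2 * y) - sin (2 * x + 2 * y)"
    unfolding ca by simp
  also have "\<dots> = 2 * sin x * cos x * (1 - cos (2 * y)) + 2 * sin y * cos y * (1 - cos (2 * x))"
    unfolding sin_add[of "2 * x"] sin_double by (simp add: algebra_simps)
  also have "\<dots> = 4 * sin x * sin y * sin (x + y)"
    unfolding cos_double_sin sin_add by algebra
  finally show ?thesis unfolding s(1) x_def[symmetric] y_def[symmetric] .
qed

text \<open>This is the affine dependence of four points of the plane, with triangle areas as
  coefficients. If all four areas have the same sign, dividing by the common sum of the weights
  exhibits the intersection of the segments ac and bd.\<close>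

lemma orient_radon:
  "of_real (orient b c d) * a + of_real (orient a b d) * c
     = of_real (orient a c d) * b + of_real (orient a b c) * d"
  "orient b c d + orient a b d = orient a c d + orient a b c"
  by (simp_all add: orient_def complex_eq_iff algebra_simps)

lemma convex_orient:
  "convex {w. orient u v w < 0}" "convex {w. orient u v w > 0}"
proof -
  have "orient u v w = inner (Complex (- Im (v - u)) (Re (v - u))) w
      - inner (Complex (- Im (v - u)) (Re (v - u))) u" for w
    by (simp add: orient_def inner_complex_def algebra_simps)
  then have "{w. orient u v w < 0} = {w. inner (Complex (- Im (v - u)) (Re (v - u))) w
      < inner (Complex (- Im (v - u)) (Re (v - u))) u}"
    "{w. orient u v w > 0} = {w. inner (Complex (- Im (v - u)) (Re (v - u))) w
      > inner (Complex (- Im (v - u)) (Re (v - u))) u}" by auto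
  then show "convex {w. orient u v w < 0}" "convex {w. orient u v w > 0}"
    by (simp_all add: convex_halfspace_lt convex_halfspace_gt)
qed

text \<open>The real parameter provides points strictly between consecutive numbered points; the
  separating chords end there.\<close>

definition angle_point :: "nat \<Rightarrow> real \<Rightarrow> complex" where
  "angle_point m t = cis (- (2 * pi * t / real m))"

lemma circle_point_eq: "circle_point m i = angle_point m (real i)"
  by (simp add: circle_point_def angle_point_def)

lemma orient_angle_point:
  "orient (angle_point m s) (angle_point m t) (angle_point m u) =
     - (4 * sin (pi * ((t - s) / m)) * sin (pi * ((u - t) / m)) * sin (pi * ((u - s) / m)))"
proof -
  have *: "(- (2 * pi * x / m) - - (2 * pi * y / m)) / 2 = - (pi * ((x - y) / m))" for x y
    by (simp add: field_simps diff_divide_distrib)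
  show ?thesis unfolding angle_point_def orient_cis * sin_minus by (simp only: mult_minus_left mult_minus_right minus_minus)
qed

lemma sin_pi_frac_pos: "0 < x \<Longrightarrow> x < real m \<Longrightarrow> sin (pi * (x / m)) > 0"
  by (rule sin_gt_zero) (auto simp: field_simps)

lemma sin_pi_frac_neg: "- real m < x \<Longrightarrow> x < 0 \<Longrightarrow> sin (pi * (x / m)) < 0"
  using sin_pi_frac_pos[of "- x" m] by (simp add: sin_minus del: sin_times_pi_eq_0)

lemma orient_circle_point_neg:
  assumes "1 \<le> a" "a < b" "b < c" "c \<le> m"
  shows "orient (circle_point m a) (circle_point m b) (circle_point m c) < 0"
  unfolding circle_point_eq orient_angle_point neg_less_0_iff_less
  using assms by (intro mult_pos_pos sin_pi_frac_pos) auto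

lemma convex_hulls_meet:
  fixes a b c d :: "'a :: real_vector"
  assumes pos: "0 < r" "0 < s" "0 < t" "0 < u"
    and sum: "r + s = t + u" and eq: "r *\<^sub>R a + s *\<^sub>R c = t *\<^sub>R b + u *\<^sub>R d"
    and A: "a \<in> A" "c \<in> A" and B: "b \<in> B" "d \<in> B"
  shows "\<not> disjnt (convex hull A) (convex hull B)"
proof -
  define z where "z = inverse (r + s) *\<^sub>R (r *\<^sub>R a + s *\<^sub>R c)"
  have "z = (inverse (r + s) * r) *\<^sub>R a + (inverse (r + s) * s) *\<^sub>R c"
    by (simp add: z_def scaleR_add_right)
  also have "\<dots> \<in> convex hull A"
  proof (rule convexD[OF convex_convex_hull])
    show "a \<in> convex hull A" "c \<in> convex hull A" using A by (auto intro: hull_inc)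
    show "inverse (r + s) * r + inverse (r + s) * s = 1" using pos by (simp add: distrib_left[symmetric])
  qed (use pos in auto)
  finally have zA: "z \<in> convex hull A" .
  have "z = (inverse (t + u) * t) *\<^sub>R b + (inverse (t + u) * u) *\<^sub>R d"
    by (simp add: z_def scaleR_add_right eq sum)
  also have "\<dots> \<in> convex hull B"
  proof (rule convexD[OF convex_convex_hull])
    show "b \<in> convex hull B" "d \<in> convex hull B" using B by (auto intro: hull_inc)
    show "inverse (t + u) * t + inverse (t + u) * u = 1" using pos by (simp add: distrib_left[symmetric])
  qed (use pos in auto)
  finally show ?thesis using zA by (auto simp: disjnt_iff)
qed

lemma hulls_meet:
  assumes "1 \<le> a" "a < b" "b < c" "c < d" "d \<le> m"
    and "a \<in> A" "c \<in> A" "b \<in> B" "d \<in> B"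
  shows "\<not> disjnt (convex hull (circle_point m ` A)) (convex hull (circle_point m ` B))"
proof -
  let ?c = "circle_point m"
  show ?thesis
  proof (rule convex_hulls_meet)
    \<comment> \<open>The numbering is clockwise, so these areas are negative; the weights are their
      negatives.\<close>
    show "0 < - orient (?c b) (?c c) (?c d)" "0 < - orient (?c a) (?c b) (?c d)"
      "0 < - orient (?c a) (?c c) (?c d)" "0 < - orient (?c a) (?c b) (?c c)"
      using assms by (simp_all add: orient_circle_point_neg)
    show "- orient (?c b) (?c c) (?c d) + - orient (?c a) (?c b) (?c d)
        = - orient (?c a) (?c c) (?c d) + - orient (?c a) (?c b) (?c c)"
      using orient_radon(2)[of "?c b" "?c c" "?c d" "?c a"] by simp
    show "(- orient (?c b) (?c c) (?c d)) *\<^sub>R ?c a + (- orient (?c a) (?c b) (?c d)) *\<^sub>R ?c c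
        = (- orient (?c a) (?c c) (?c d)) *\<^sub>R ?c b + (- orient (?c a) (?c b) (?c c)) *\<^sub>R ?c d"
      using orient_radon(1)[of "?c b" "?c c" "?c d" "?c a"]
      by (simp add: scaleR_conv_of_real algebra_simps)
  qed (use assms in auto)
qed

text \<open>The chord that cuts the arc \<open>{p..q}\<close> off runs through the points at \<open>p - 1/2\<close> and
  \<open>q + 1/2\<close>, so none of the points \<open>1, \<dots>, m\<close> lies on it.\<close>

lemma hulls_disjoint_interval:
  assumes "2 \<le> p" "p \<le> q" "q \<le> m" and B: "B \<subseteq> {p..q}" and A: "A \<subseteq> {1..m} - {p..q}"
  shows "disjnt (convex hull (circle_point m ` A)) (convex hull (circle_point m ` B))"
proof -
  let ?o = "orient (angle_point m (p - 1/2)) (angle_point m (q + 1/2))"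
  \<comment> \<open>\<open>2 \<le> p\<close> keeps the arc from p - 1/2 to q + 1/2 shorter than the
    whole circle, so the chord does not degenerate.\<close>
  have base: "sin (pi * ((real q + 1/2 - (real p - 1/2)) / m)) > 0"
    using assms(1-3) by (intro sin_pi_frac_pos) auto
  have pos: "?o (circle_point m x) > 0" if "x \<in> {p..q}" for x
  proof -
    have "sin (pi * ((real x - (real q + 1/2)) / m)) < 0"
      using that assms(1-3) by (intro sin_pi_frac_neg) auto
    moreover have "sin (pi * ((real x - (real p - 1/2)) / m)) > 0"
      using that assms(1-3) by (intro sin_pi_frac_pos) auto
    ultimately show ?thesis
      unfolding circle_point_eq orient_angle_point neg_0_less_iff_less
      using mult_pos_pos[OF mult_pos_pos[OF zero_less_numeral base]]
      by (metis (no_types) base mult_neg_pos mult_pos_neg mult_pos_pos zero_less_numeral)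
  qed
  have neg: "?o (circle_point m x) < 0" if x: "x \<in> {1..m} - {p..q}" for x
  proof -
    have "x < p \<or> q < x" using x by auto
    \<comment> \<open>Off the arc both factors have the same sign, negative before it and positive
      after it; on the arc the signs differ.\<close>
    then have "sin (pi * ((real x - (real q + 1/2)) / m)) * sin (pi * ((real x - (real p - 1/2)) / m)) > 0"
    proof
      assume "x < p"
      then show ?thesis
        using x assms(1-3) by (intro mult_neg_neg sin_pi_frac_neg) auto
    next
      assume "q < x"
      then have "real x \<ge> real q + 1" by linarith
      then show ?thesis
        using x assms(1-3) by (intro mult_pos_pos sin_pi_frac_pos) auto
    qed
    then show ?thesis
      unfolding circle_point_eq orient_angle_point neg_less_0_iff_less mult.assoc
      using base by (metis (no_types) mult_pos_pos zero_less_numeral mult.assoc)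
  qed
  have "convex hull (circle_point m ` B) \<subseteq> {w. ?o w > 0}"
    using pos B by (intro hull_minimal convex_orient) auto
  moreover have "convex hull (circle_point m ` A) \<subseteq> {w. ?o w < 0}"
    using neg A by (intro hull_minimal convex_orient) auto
  ultimately show ?thesis by (fastforce simp: disjnt_iff)
qed

text \<open>The block with the larger minimum spans an arc. A point of A inside that arc would
  interleave with the two ends of the arc and with \<open>Min A\<close>, which lies before it; so A
  stays outside and a chord separates the hulls.\<close>

lemma hulls_disjoint:
  assumes A: "A \<subseteq> {1..m}" "A \<noteq> {}" and B: "B \<subseteq> {1..m}" "B \<noteq> {}"
    and "disjnt A B" "Min A < Min B" "\<not> cross A B"
  shows "disjnt (convex hull (circle_point m ` A)) (convex hull (circle_point m ` B))"
proof (rule hulls_disjoint_interval)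
  have fin: "finite A" "finite B" using A B finite_subset by blast+
  have mem: "Min A \<in> A" "Min B \<in> B" "Max B \<in> B" using A B fin by auto
  show "2 \<le> Min B" using A mem \<open>Min A < Min B\<close> by fastforce
  show "Min B \<le> Max B" using fin B by simp
  show "Max B \<le> m" using mem B by fastforce
  show "B \<subseteq> {Min B..Max B}" using fin B by auto
  show "A \<subseteq> {1..m} - {Min B..Max B}"
  proof (intro subsetI DiffI notI)
    fix a assume a: "a \<in> A" "a \<in> {Min B..Max B}"
    then have "a \<noteq> Min B" "a \<noteq> Max B" using mem \<open>disjnt A B\<close> by (auto simp: disjnt_iff)
    then have "cross A B"
      using a mem \<open>Min A < Min B\<close> by (intro crossI[of "Min A" A a "Min B" B "Max B"]) auto
    then show False using \<open>\<not> cross A B\<close> by blast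
  qed (use A in auto)
qed

lemma disjnt_hulls_iff:
  assumes A: "A \<subseteq> {1..m}" "A \<noteq> {}" and B: "B \<subseteq> {1..m}" "B \<noteq> {}" and "disjnt A B"
  shows "disjnt (convex hull (circle_point m ` A)) (convex hull (circle_point m ` B)) \<longleftrightarrow> \<not> cross A B"
proof
  assume *: "disjnt (convex hull (circle_point m ` A)) (convex hull (circle_point m ` B))"
  have in_range: "1 \<le> x" "x \<le> m" if "x \<in> A \<union> B" for x using that A B by auto
  show "\<not> cross A B"
  proof
    assume "cross A B"
    then show False
    proof (cases rule: cross_cases)
      case (1 a b c d)
      then have "a \<in> A \<union> B" "d \<in> A \<union> B" by auto
      with 1(4) hulls_meet[OF _ 1(1-3), of m A B] hulls_meet[OF _ 1(1-3), of m B A] in_range *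
      show False by (metis disjnt_sym)
    qed
  qed
next
  assume *: "\<not> cross A B"
  have "finite A" "finite B" using A B finite_subset by blast+
  then have "Min A \<in> A" "Min B \<in> B" using A B by auto
  then have "Min A \<noteq> Min B" using \<open>disjnt A B\<close> by (metis disjnt_iff)
  then show "disjnt (convex hull (circle_point m ` A)) (convex hull (circle_point m ` B))"
  proof (cases "Min A < Min B")
    case True
    then show ?thesis using hulls_disjoint[OF A B \<open>disjnt A B\<close> _ *] by blast
  next
    case False
    then have "Min B < Min A" using \<open>Min A \<noteq> Min B\<close> by simp
    moreover have "\<not> cross B A" using * cross_sym by blast
    ultimately show ?thesis
      using hulls_disjoint[OF B A disjnt_sym[OF \<open>disjnt A B\<close>]] disjnt_sym by blast
  qed
qed

text \<open>This is the only link to the geometric definition; from here on, membership in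
  \<open>NC\<close> is handled through interleaving.\<close>

lemma mem_NC_iff:
  "P \<in> NC m \<longleftrightarrow> partition_on {1..m} P \<and> (\<forall>A\<in>P. \<forall>B\<in>P. A \<noteq> B \<longrightarrow> \<not> cross A B)"
proof -
  have "disjnt (convex hull (circle_point m ` A)) (convex hull (circle_point m ` B)) \<longleftrightarrow> \<not> cross A B"
    if "partition_on {1..m} P" "A \<in> P" "B \<in> P" "A \<noteq> B" for A B
  proof (rule disjnt_hulls_iff)
    show "A \<subseteq> {1..m}" "B \<subseteq> {1..m}" using that partition_onD1[OF that(1)] by auto
    show "A \<noteq> {}" "B \<noteq> {}" using that partition_onD3[OF that(1)] by auto
    show "disjnt A B" using pairwiseD[OF partition_onD2[OF that(1)] that(2-4)] .
  qed
  then show ?thesis unfolding NC_def noncrossing_def pairwise_def mem_Collect_eq by meson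
qed

section \<open>Merging blocks\<close>

lemma partition_on_block:
  assumes "partition_on {1..m::nat} P" "B \<in> P"
  shows "B \<noteq> {}" "B \<subseteq> {1..m}" "finite B" "Min B \<in> B"
proof -
  show *: "B \<noteq> {}" "B \<subseteq> {1..m}"
    using assms unfolding partition_on_def by blast+
  show "finite B" by (rule finite_subset[OF *(2)]) simp
  with * show "Min B \<in> B" by simp
qed

lemma partition_on_eqI:
  assumes "partition_on A P" "B \<in> P" "C \<in> P" "x \<in> B" "x \<in> C"
  shows "B = C"
  using assms pairwiseD[OF partition_onD2[OF assms(1)]] by (auto simp: disjnt_iff)

lemma partition_on_obtain_block:
  assumes "partition_on A P" "x \<in> A"
  obtains B where "B \<in> P" "x \<in> B"
  using assms by (auto simp: partition_on_def)

lemma partition_on_finite: "partition_on {1..m::nat} P \<Longrightarrow> finite P"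
  by (metis finite_UnionD finite_atLeastAtMost partition_onD1)

lemma Min_inj_on_partition:
  assumes "partition_on {1..m::nat} P"
  shows "inj_on Min P"
  by (rule inj_onI) (metis assms partition_on_block(4) partition_on_eqI)

lemma mergesD:
  assumes P: "partition_on {1..m} \<sigma>" and M: "merges \<sigma> \<tau> B1 B2"
  shows "\<sigma> - \<tau> = {B1, B2}" "B1 \<union> B2 \<notin> \<sigma>" "Min (B1 \<union> B2) = Min B1" "Min B1 < Min B2"
    "partition_on {1..m} \<tau>" "refines {1..m} \<sigma> \<tau>" "Suc (card \<tau>) = card \<sigma>"
    "Min ` \<tau> = Min ` \<sigma> - {Min B2}" "disjnt B1 B2"
proof -
  have B: "B1 \<in> \<sigma>" "B2 \<in> \<sigma>" "B1 \<noteq> B2" "\<tau> = insert (B1 \<union> B2) (\<sigma> - {B1, B2})"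
    "Min (B1 \<union> B2) \<in> B1"
    using M by (auto simp: merges_def)
  note b1 = partition_on_block[OF P B(1)] and b2 = partition_on_block[OF P B(2)]
  show dj: "disjnt B1 B2"
    using pairwiseD[OF partition_onD2[OF P] B(1-3)] .
  have "B1 \<union> B2 \<noteq> B1" "B1 \<union> B2 \<noteq> B2" using dj b1(1) b2(1) unfolding disjnt_def by blast+
  then show nin: "B1 \<union> B2 \<notin> \<sigma>"
    using partition_on_eqI[OF P _ B(1)] b1(4) by blast
  then show "\<sigma> - \<tau> = {B1, B2}" using B by auto
  have "Min (B1 \<union> B2) \<le> Min B1" using b1 b2 by (intro Min_antimono) auto
  moreover have "Min B1 \<le> Min (B1 \<union> B2)" using b1 B(5) by simp
  ultimately show mn: "Min (B1 \<union> B2) = Min B1" by simp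
  have "Min B1 \<le> Min B2" unfolding mn[symmetric] using b1 b2 by (intro Min_antimono) auto
  moreover have "Min B1 \<noteq> Min B2" using b1(4) b2(4) dj by (metis disjnt_iff)
  ultimately show "Min B1 < Min B2" by simp
  have un: "\<Union>\<tau> = \<Union>\<sigma>" using B by auto
  have disj: "disjnt C D" if "C \<in> \<sigma>" "D \<in> \<sigma>" "C \<noteq> D" for C D
    using pairwiseD[OF partition_onD2[OF P] that] .
  show pt: "partition_on {1..m} \<tau>"
  proof (rule partition_onI)
    show "\<Union>\<tau> = {1..m}" using un partition_onD1[OF P] by simp
    show "{} \<notin> \<tau>" using B b1 partition_onD3[OF P] by auto
    fix C D assume CD: "C \<in> \<tau>" "D \<in> \<tau>" "C \<noteq> D"
    have *: "disjnt (B1 \<union> B2) E" if "E \<in> \<sigma> - {B1, B2}" for E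
      using disj[of B1 E] disj[of B2 E] B that by auto
    from CD consider "C = B1 \<union> B2" "D \<in> \<sigma> - {B1, B2}" | "D = B1 \<union> B2" "C \<in> \<sigma> - {B1, B2}"
      | "C \<in> \<sigma>" "D \<in> \<sigma>" unfolding B(4) by blast
    then show "disjnt C D"
      by cases (use * disjnt_sym disj CD(3) in metis)+
  qed
  show "refines {1..m} \<sigma> \<tau>"
    using P pt unfolding refines_def B(4) by auto
  have fin: "finite \<sigma>" using P by (rule partition_on_finite)
  then have "card \<tau> = Suc (card (\<sigma> - {B1, B2}))"
    unfolding B(4) using nin by simp
  moreover have "card (\<sigma> - {B1, B2}) = card \<sigma> - 2"
    using B(1-3) fin by (subst card_Diff_subset) auto
  moreover have "card {B1, B2} \<le> card \<sigma>" using fin B by (intro card_mono) auto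
  ultimately show "Suc (card \<tau>) = card \<sigma>" using B(3) by auto
  show "Min ` \<tau> = Min ` \<sigma> - {Min B2}"
  proof -
    have "Min ` (\<sigma> - {B2}) = Min ` \<sigma> - Min ` {B2}"
      using Min_inj_on_partition[OF P] B(2) by (intro inj_on_image_set_diff) auto
    moreover have "Min ` \<tau> = Min ` (\<sigma> - {B2})"
      unfolding B(4) using B(1,3) mn by auto
    ultimately show ?thesis by simp
  qed
qed

text \<open>The blocks lost in the step determine the pair, and the order of their minima determines
  which is which. This makes the description in \<open>cover_label\<close> well defined.\<close>

lemma merges_unique:
  assumes P: "partition_on {1..m} \<sigma>" and M: "merges \<sigma> \<tau> B1 B2" and N: "merges \<sigma> \<tau> C1 C2"
  shows "C1 = B1" "C2 = B2"
proof -
  have "{B1, B2} = {C1, C2}" using mergesD(1)[OF P M] mergesD(1)[OF P N] by simp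
  moreover have "\<not> (C1 = B2 \<and> C2 = B1)"
    using mergesD(4)[OF P M] mergesD(4)[OF P N] by auto
  ultimately show "C1 = B1" "C2 = B2" by (auto simp: doubleton_eq_iff)
qed

lemma less_block_iff:
  fixes B :: "nat set"
  assumes "finite B" "B \<noteq> {}"
  shows "(\<forall>y\<in>B. x < y) \<longleftrightarrow> x < Min B"
  using assms by simp

lemma cover_label_eq:
  assumes P: "partition_on {1..m} \<sigma>" and M: "merges \<sigma> \<tau> B1 B2"
  shows "cover_label \<sigma> \<tau> = Max {x \<in> B1. x < Min B2}"
proof -
  have "B2 \<in> \<sigma>" using M by (simp add: merges_def)
  note b2 = partition_on_block[OF P this]
  have "cover_label \<sigma> \<tau> = Max {x \<in> B1. \<forall>y\<in>B2. x < y}"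
    unfolding cover_label_def
    by (rule the_equality) (use M merges_unique[OF P M] in blast)+
  then show ?thesis using less_block_iff[OF b2(3,1)] by simp
qed

lemma cover_label_bounds:
  assumes P: "partition_on {1..m} \<sigma>" and M: "merges \<sigma> \<tau> B1 B2"
  shows "cover_label \<sigma> \<tau> \<in> B1" "0 < cover_label \<sigma> \<tau>" "cover_label \<sigma> \<tau> < Min B2"
proof -
  have "B1 \<in> \<sigma>" using M by (simp add: merges_def)
  note b1 = partition_on_block[OF P this]
  have "finite {x \<in> B1. x < Min B2}" using b1 by simp
  moreover have "Min B1 \<in> {x \<in> B1. x < Min B2}" using b1 mergesD(4)[OF P M] by simp
  ultimately have "cover_label \<sigma> \<tau> \<in> {x \<in> B1. x < Min B2}"
    unfolding cover_label_eq[OF P M] by (intro Max_in) auto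
  then show "cover_label \<sigma> \<tau> \<in> B1" "0 < cover_label \<sigma> \<tau>" "cover_label \<sigma> \<tau> < Min B2"
    using b1(2) by auto
qed

lemma NC_partition_on: "P \<in> NC m \<Longrightarrow> partition_on {1..m} P"
  by (simp add: mem_NC_iff)

section \<open>Refining a strict refinement by a single merge inside \<open>NC\<close>\<close>

lemma adjacent_split:
  fixes T :: "nat set"
  assumes "a \<in> T" "b \<in> T" "f a \<noteq> f b"
  obtains a b where "a \<in> T" "b \<in> T" "a < b" "f a \<noteq> f b" "\<And>x. x \<in> T \<Longrightarrow> \<not> (a < x \<and> x < b)"
proof -
  \<comment> \<open>The pair is chosen at least distance: a point between a and b differs in value
    from one of them and would give a closer pair.\<close>
  define P where "P = (\<lambda>d. \<exists>a\<in>T. \<exists>b\<in>T. f a \<noteq> f b \<and> a < b \<and> b - a = d)"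
  have "\<exists>d. P d" using assms unfolding P_def by (metis linorder_neqE_nat)
  then obtain d where d: "P d" "\<And>e. P e \<Longrightarrow> d \<le> e" by (metis LeastI_ex Least_le)
  then obtain a b where ab: "a \<in> T" "b \<in> T" "f a \<noteq> f b" "a < b" "b - a = d"
    by (auto simp: P_def)
  moreover have "\<not> (a < x \<and> x < b)" if "x \<in> T" for x
  proof
    assume x: "a < x \<and> x < b"
    have "f a \<noteq> f x \<or> f x \<noteq> f b" using ab by auto
    then have "P (x - a) \<or> P (b - x)" using ab x that unfolding P_def by blast
    then show False using d(2) ab x by fastforce
  qed
  ultimately show ?thesis using that by blast
qed

text \<open>Since C has no point from a to b, both lie in the same gap of C. If a crossing of the
  union uses one point from A and one from B, then replacing one of them by a or b yields a crossing
  of A or of B alone.\<close>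

lemma cross_Un_adjacent:
  assumes "a \<in> A" "b \<in> B" and gap: "\<And>x. x \<in> C \<Longrightarrow> x < a \<or> b < x" and "a < b"
    and "cross (A \<union> B) C"
  shows "cross A C \<or> cross B C"
proof (rule ccontr)
  assume n: "\<not> (cross A C \<or> cross B C)"
  obtain p r q s where pr: "p \<in> A \<union> B" "r \<in> A \<union> B" and qs: "q \<in> C" "s \<in> C"
    "q < r" "r < s" "p < q \<or> s < p"
    using assms(5) unfolding cross_def by blast
  have nA: "\<not> (q < y \<and> y < s \<and> (x < q \<or> s < x))" if "x \<in> A" "y \<in> A" for x y
    using n that qs crossI[of x A y q C s] by blast
  have nB: "\<not> (q < y \<and> y < s \<and> (x < q \<or> s < x))" if "x \<in> B" "y \<in> B" for x y
    using n that qs crossI[of x B y q C s] by blast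
  consider "p \<in> A" "r \<in> A" | "p \<in> B" "r \<in> B" | "p \<in> A" "r \<in> B" | "p \<in> B" "r \<in> A"
    using pr by blast
  then show False
  proof cases
    case 1
    then show ?thesis using nA[of p r] qs by blast
  next
    case 2
    then show ?thesis using nB[of p r] qs by blast
  next
    case 3
    have "\<not> (q < a \<and> a < s)" "\<not> (b < q \<or> s < b)"
      using nA[of p a] nB[of b r] 3 assms(1,2) qs by blast+
    then show ?thesis using gap[OF qs(1)] gap[OF qs(2)] \<open>a < b\<close> by linarith
  next
    case 4
    have "\<not> (q < b \<and> b < s)" "\<not> (a < q \<or> s < a)"
      using nB[of p b] nA[of a r] 4 assms(1,2) qs by blast+
    then show ?thesis using gap[OF qs(1)] gap[OF qs(2)] \<open>a < b\<close> by linarith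
  qed
qed

text \<open>An arbitrary merge inside a block T of the coarser partition may create crossings.
  Merging the blocks of two points that are adjacent within T does not: blocks inside T have no
  point between the two, and blocks outside T lie in another block of \<open>\<tau>\<close>, which T
  does not cross.\<close>

lemma merge_below:
  assumes \<sigma>: "\<sigma> \<in> NC m" and \<tau>: "\<tau> \<in> NC m" and ref: "refines {1..m} \<sigma> \<tau>" and "\<sigma> \<noteq> \<tau>"
  obtains \<rho> B1 B2 where "merges \<sigma> \<rho> B1 B2" "\<rho> \<in> NC m" "refines {1..m} \<rho> \<tau>"
proof -
  have ps: "partition_on {1..m} \<sigma>" and pt: "partition_on {1..m} \<tau>"
    using \<sigma> \<tau> NC_partition_on by blast+
  have "\<not> refines {1..m} \<tau> \<sigma>" using ref \<open>\<sigma> \<noteq> \<tau>\<close> refines_asym by metis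
  then have "\<exists>T\<in>\<tau>. \<not> (\<exists>S\<in>\<sigma>. T \<subseteq> S)"
    unfolding refines_def using ps pt by simp
  then obtain T where T: "T \<in> \<tau>" "\<And>S. S \<in> \<sigma> \<Longrightarrow> \<not> T \<subseteq> S" by blast
  define f where "f x = (THE S. S \<in> \<sigma> \<and> x \<in> S)" for x
  have feq: "f x = S" if "S \<in> \<sigma>" "x \<in> S" for x S
    unfolding f_def by (rule the_equality) (use that partition_on_eqI[OF ps] in auto)
  have fS: "f x \<in> \<sigma>" "x \<in> f x" if x: "x \<in> {1..m}" for x
  proof -
    obtain S where S: "S \<in> \<sigma>" "x \<in> S" using partition_on_obtain_block[OF ps x] by blast
    then show "f x \<in> \<sigma>" "x \<in> f x" using feq[OF S] by auto
  qed
  have sub: "T \<subseteq> {1..m}" using partition_on_block(2)[OF pt T(1)] .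
  have inT: "S \<subseteq> T" if S: "S \<in> \<sigma>" "x \<in> S" "x \<in> T" for S x
  proof -
    obtain T' where T': "T' \<in> \<tau>" "S \<subseteq> T'" using ref S(1) unfolding refines_def by blast
    then have "T' = T" using partition_on_eqI[OF pt T'(1) T(1), of x] S by blast
    then show ?thesis using T' by blast
  qed
  define a0 where "a0 = Min T"
  have "a0 \<in> T" using partition_on_block(4)[OF pt T(1)] a0_def by simp
  then have "\<not> T \<subseteq> f a0" using T(2)[of "f a0"] fS(1)[of a0] sub by blast
  then obtain b0 where "b0 \<in> T" "b0 \<notin> f a0" by blast
  then have "f a0 \<noteq> f b0" using fS(2)[of b0] sub by blast
  from adjacent_split[of a0 T b0 f, OF \<open>a0 \<in> T\<close> \<open>b0 \<in> T\<close> this]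
  obtain a b where ab: "a \<in> T" "b \<in> T" "a < b" "f a \<noteq> f b"
    and gap: "\<And>x. x \<in> T \<Longrightarrow> \<not> (a < x \<and> x < b)" by blast
  define A B where "A = f a" and "B = f b"
  have A: "A \<in> \<sigma>" "a \<in> A" "A \<subseteq> T" and B: "B \<in> \<sigma>" "b \<in> B" "B \<subseteq> T" and "A \<noteq> B"
    using ab fS[of a] fS[of b] sub inT[of "f a" a] inT[of "f b" b] unfolding A_def B_def by blast+
  define \<rho> where "\<rho> = insert (A \<union> B) (\<sigma> - {A, B})"
  have "Min (A \<union> B) \<in> A \<union> B"
    using partition_on_block[OF ps A(1)] partition_on_block[OF ps B(1)] by (intro Min_in) auto
  then have "merges \<sigma> \<rho> A B \<or> merges \<sigma> \<rho> B A"
    using A B \<open>A \<noteq> B\<close> unfolding merges_def \<rho>_def by (auto simp: Un_commute insert_commute)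
  then obtain B1 B2 where M: "merges \<sigma> \<rho> B1 B2" by blast
  have pr: "partition_on {1..m} \<rho>" using mergesD(5)[OF ps M] .
  have nc: "\<not> cross C D" if "C \<in> \<sigma>" "D \<in> \<sigma>" "C \<noteq> D" for C D
    using \<sigma> that unfolding mem_NC_iff by blast
  have AB: "\<not> cross (A \<union> B) C" if C: "C \<in> \<sigma> - {A, B}" for C
  proof
    assume cr: "cross (A \<union> B) C"
    show False
    proof (cases "C \<subseteq> T")
      case True
      have "a \<notin> C" "b \<notin> C" using C A B partition_on_eqI[OF ps] by blast+
      then have "x < a \<or> b < x" if "x \<in> C" for x
        using gap[of x] True that by (metis linorder_neqE_nat subsetD)
      then have "cross A C \<or> cross B C"
        using cross_Un_adjacent[of a A b B C] A B ab cr by blast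
      then show False using nc A B C by blast
    next
      case False
      obtain T' where T': "T' \<in> \<tau>" "C \<subseteq> T'" using ref C unfolding refines_def by blast
      then have "T' \<noteq> T" using False by blast
      moreover have "cross T T'" using cross_mono[OF cr, of T T'] A B T' by blast
      ultimately show False using \<tau> T T' unfolding mem_NC_iff by blast
    qed
  qed
  have "\<rho> \<in> NC m"
    unfolding mem_NC_iff
  proof (intro conjI pr ballI impI)
    fix C D assume "C \<in> \<rho>" "D \<in> \<rho>" "C \<noteq> D"
    then consider "C = A \<union> B" "D \<in> \<sigma> - {A, B}" | "D = A \<union> B" "C \<in> \<sigma> - {A, B}"
      | "C \<in> \<sigma>" "D \<in> \<sigma>" unfolding \<rho>_def by blast
    then show "\<not> cross C D"
      by cases (use AB nc \<open>C \<noteq> D\<close> cross_sym in metis)+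
  qed
  moreover have "refines {1..m} \<rho> \<tau>"
    using pr pt ref A(3) B(3) T(1) unfolding refines_def by (auto simp: \<rho>_def)
  ultimately show ?thesis using that M by blast
qed

section \<open>Maximal chains as paths of merges\<close>

definition nc_bot :: "nat \<Rightarrow> nat set set" where
  "nc_bot m = (\<lambda>x. {x}) ` {1..m}"

definition nc_top :: "nat \<Rightarrow> nat set set" where
  "nc_top m = {{1..m}}"

definition nc_cover :: "nat \<Rightarrow> nat set set rel" where
  "nc_cover m = {(\<sigma>, \<tau>). \<sigma> \<in> NC m \<and> \<tau> \<in> NC m \<and> (\<exists>B1 B2. merges \<sigma> \<tau> B1 B2)}"

lemma nc_coverE:
  assumes "(\<sigma>, \<tau>) \<in> nc_cover m"
  obtains B1 B2 where "\<sigma> \<in> NC m" "\<tau> \<in> NC m" "merges \<sigma> \<tau> B1 B2" "partition_on {1..m} \<sigma>"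
  using assms NC_partition_on unfolding nc_cover_def by blast

lemma not_cross_singleton: "\<not> cross {x} B" "\<not> cross A {x}"
  by (auto simp: cross_def)

lemma nc_bot_NC: "nc_bot m \<in> NC m"
  by (auto simp: mem_NC_iff nc_bot_def partition_on_singletons not_cross_singleton)

lemma nc_top_NC: "0 < m \<Longrightarrow> nc_top m \<in> NC m"
  by (simp add: mem_NC_iff nc_top_def partition_on_space)

lemma nc_bot_refines: "\<sigma> \<in> NC m \<Longrightarrow> refines {1..m} (nc_bot m) \<sigma>"
  using NC_partition_on[of \<sigma> m] NC_partition_on[OF nc_bot_NC, of m]
  by (auto simp: refines_def nc_bot_def elim: partition_on_obtain_block)

lemma refines_nc_top:
  assumes "0 < m" "\<sigma> \<in> NC m"
  shows "refines {1..m} \<sigma> (nc_top m)"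
  using NC_partition_on[OF assms(2)] NC_partition_on[OF nc_top_NC[OF assms(1)]] partition_on_block(2)
  unfolding refines_def nc_top_def by blast

lemma Min_nc_bot: "Min ` nc_bot m = {1..m}"
  by (simp add: nc_bot_def image_image)

lemma Min_nc_top: "0 < m \<Longrightarrow> Min ` nc_top m = {1}"
  by (auto simp: nc_top_def intro!: Min_eqI)

lemma nc_cover_refines: "(\<sigma>, \<tau>) \<in> nc_cover m \<Longrightarrow> refines {1..m} \<sigma> \<tau>"
  using nc_coverE mergesD(6) by metis

lemma nc_cover_card: "(\<sigma>, \<tau>) \<in> nc_cover m \<Longrightarrow> card \<sigma> = Suc (card \<tau>)"
  using nc_coverE mergesD(7) by metis

lemma refines_imp_nc_cover_rtrancl:
  assumes "\<sigma> \<in> NC m" "\<tau> \<in> NC m" "refines {1..m} \<sigma> \<tau>"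
  shows "(\<sigma>, \<tau>) \<in> (nc_cover m)\<^sup>*"
  using assms
proof (induction "card \<sigma>" arbitrary: \<sigma> rule: less_induct)
  case less
  show ?case
  proof (cases "\<sigma> = \<tau>")
    case False
    obtain \<rho> B1 B2 where \<rho>: "merges \<sigma> \<rho> B1 B2" "\<rho> \<in> NC m" "refines {1..m} \<rho> \<tau>"
      using merge_below[OF less.prems False] .
    then have c: "(\<sigma>, \<rho>) \<in> nc_cover m" using less.prems by (auto simp: nc_cover_def)
    then have "card \<rho> < card \<sigma>" using nc_cover_card by fastforce
    then have "(\<rho>, \<tau>) \<in> (nc_cover m)\<^sup>*" using less \<rho> by blast
    then show ?thesis using c by (rule converse_rtrancl_into_rtrancl[rotated])
  qed simp
qed

lemma rtrancl_nc_cover_card: "(\<sigma>, \<tau>) \<in> (nc_cover m)\<^sup>* \<Longrightarrow> \<sigma> = \<tau> \<or> card \<tau> < card \<sigma>"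
  by (induction rule: rtrancl_induct) (use nc_cover_card in fastforce)+

lemma refines_card:
  assumes "\<sigma> \<in> NC m" "\<tau> \<in> NC m" "refines {1..m} \<sigma> \<tau>"
  shows "\<sigma> = \<tau> \<or> card \<tau> < card \<sigma>"
  using rtrancl_nc_cover_card refines_imp_nc_cover_rtrancl assms by blast

text \<open>The number of blocks drops by exactly one along a cover and strictly along any proper
  refinement, which leaves no room in between.\<close>

lemma nc_cover_between:
  assumes c: "(\<sigma>, \<tau>) \<in> nc_cover m" and "\<rho> \<in> NC m" "refines {1..m} \<sigma> \<rho>" "refines {1..m} \<rho> \<tau>"
  shows "\<rho> = \<sigma> \<or> \<rho> = \<tau>"
proof -
  have "\<sigma> \<in> NC m" "\<tau> \<in> NC m" using c by (auto simp: nc_cover_def)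
  then show ?thesis
    using refines_card[of \<sigma> m \<rho>] refines_card[of \<rho> m \<tau>] assms nc_cover_card[OF c] by fastforce
qed

lemma successively_nc_cover_NC:
  assumes "successively (\<lambda>x y. (x, y) \<in> nc_cover m) c" "c \<noteq> []" "hd c \<in> NC m"
  shows "set c \<subseteq> NC m"
  using assms
proof (induction c)
  case (Cons x c)
  then show ?case by (cases c) (auto simp: nc_cover_def)
qed simp

text \<open>Walking up the path as long as the next entry is below \<open>\<rho>\<close> ends either
  at the last entry or with \<open>\<rho>\<close> squeezed between two consecutive entries, where a
  cover admits nothing new.\<close>

lemma comparable_mem_chain:
  assumes "successively (\<lambda>x y. (x, y) \<in> nc_cover m) c" "c \<noteq> []" "\<rho> \<in> NC m"
    and "refines {1..m} (hd c) \<rho>" "refines {1..m} \<rho> (last c)"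
    and "\<And>x. x \<in> set c \<Longrightarrow> refines {1..m} x \<rho> \<or> refines {1..m} \<rho> x"
  shows "\<rho> \<in> set c"
  using assms
proof (induction c rule: induct_list012)
  case (2 x)
  then show ?case using refines_asym[of "{1..m}" x \<rho>] by simp
next
  case (3 x y zs)
  show ?case
  proof (cases "refines {1..m} y \<rho>")
    case True
    have "\<rho> \<in> set (y # zs)" by (rule "3.IH"(2)) (use 3 True in auto)
    then show ?thesis by simp
  next
    case False
    then have "refines {1..m} \<rho> y" using "3.prems"(6)[of y] by simp
    then have "\<rho> = x \<or> \<rho> = y" using nc_cover_between[of x y m \<rho>] "3.prems" by simp
    then show ?thesis by auto
  qed
qed simp

lemma sorted_wrt_irrefl_distinct:
  "sorted_wrt R xs \<Longrightarrow> (\<And>x. \<not> R x x) \<Longrightarrow> distinct xs"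
  by (induction xs) auto

lemma sorted_wrt_total: "sorted_wrt R xs \<Longrightarrow> x \<in> set xs \<Longrightarrow> y \<in> set xs \<Longrightarrow> x = y \<or> R x y \<or> R y x"
  by (induction xs) auto

definition paths :: "'a rel \<Rightarrow> 'a \<Rightarrow> 'a \<Rightarrow> 'a list set" where
  "paths R a b = {c. c \<noteq> [] \<and> hd c = a \<and> last c = b \<and> successively (\<lambda>x y. (x, y) \<in> R) c}"

lemma path_is_maximal_chain:
  assumes "0 < m" and c: "c \<in> paths (nc_cover m) (nc_bot m) (nc_top m)"
  shows "nc_maximal_chain m c"
proof -
  have ne: "c \<noteq> []" and hd: "hd c = nc_bot m" and last: "last c = nc_top m"
    and suc: "successively (\<lambda>x y. (x, y) \<in> nc_cover m) c"
    using c by (auto simp: paths_def)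
  have sub: "set c \<subseteq> NC m" using successively_nc_cover_NC[OF suc ne] hd nc_bot_NC by simp
  have "successively (refines {1..m}) c"
    using suc by (rule successively_mono) (rule nc_cover_refines)
  moreover have "transp (refines {1..m})" unfolding transp_def using refines_trans by blast
  ultimately have sorted: "sorted_wrt (refines {1..m}) c"
    by (simp add: successively_conv_sorted_wrt)
  have "successively (\<lambda>x y. card x > card y) c"
    using suc by (rule successively_mono) (auto dest: nc_cover_card)
  then have "sorted_wrt (\<lambda>x y. card x > card y) c"
    by (subst (asm) successively_conv_sorted_wrt) (auto simp: transp_def)
  then have "distinct c" by (rule sorted_wrt_irrefl_distinct) simp
  have chain: "pred_on.chain (NC m) (refines {1..m}) (set c)"
    using sub sorted_wrt_total[OF sorted] by (auto simp: pred_on.chain_def)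
  have "\<not> (pred_on.chain (NC m) (refines {1..m}) S \<and> set c \<subset> S)" for S
  proof
    assume S: "pred_on.chain (NC m) (refines {1..m}) S \<and> set c \<subset> S"
    then obtain \<rho> where \<rho>: "\<rho> \<in> S" "\<rho> \<notin> set c" by blast
    then have NC: "\<rho> \<in> NC m" using S by (auto simp: pred_on.chain_def)
    have cmp: "refines {1..m} x \<rho> \<or> refines {1..m} \<rho> x" if "x \<in> set c" for x
    proof -
      have "x \<in> S" "x \<noteq> \<rho>" using that S \<rho> by auto
      then show ?thesis using S \<rho>(1) unfolding pred_on.chain_def by blast
    qed
    have "\<rho> \<in> set c"
      using comparable_mem_chain[OF suc ne NC _ _ cmp] nc_bot_refines[OF NC]
        refines_nc_top[OF assms(1) NC] hd last by simp
    then show False using \<rho> by blast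
  qed
  then have "pred_on.maxchain (NC m) (refines {1..m}) (set c)"
    unfolding pred_on.maxchain_def using chain by blast
  then show ?thesis using \<open>distinct c\<close> sorted by (simp add: nc_maximal_chain_def)
qed

text \<open>Between two consecutive entries \<open>merge_below\<close> supplies a single merge. Its
  result is comparable with every entry, so maximality puts it on the chain, and it can only be the
  upper of the two entries.\<close>

lemma maximal_chain_is_path:
  assumes "0 < m" and c: "nc_maximal_chain m c"
  shows "c \<in> paths (nc_cover m) (nc_bot m) (nc_top m)"
proof -
  have max: "pred_on.maxchain (NC m) (refines {1..m}) (set c)" and dist: "distinct c"
    and sorted: "sorted_wrt (refines {1..m}) c"
    using c by (auto simp: nc_maximal_chain_def)
  have chain: "pred_on.chain (NC m) (refines {1..m}) (set c)"
    and nomore: "\<And>S. pred_on.chain (NC m) (refines {1..m}) S \<Longrightarrow> \<not> set c \<subset> S"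
    using max by (auto simp: pred_on.maxchain_def)
  have sub: "set c \<subseteq> NC m" using chain by (auto simp: pred_on.chain_def)
  have closed: "\<rho> \<in> set c" if \<rho>: "\<rho> \<in> NC m"
    "\<And>x. x \<in> set c \<Longrightarrow> refines {1..m} x \<rho> \<or> refines {1..m} \<rho> x" for \<rho>
  proof (rule ccontr)
    assume "\<rho> \<notin> set c"
    moreover have "pred_on.chain (NC m) (refines {1..m}) (insert \<rho> (set c))"
      using chain \<rho> unfolding pred_on.chain_def by blast
    ultimately show False using nomore by blast
  qed
  have bot: "nc_bot m \<in> set c" using closed nc_bot_NC nc_bot_refines sub by blast
  have top: "nc_top m \<in> set c" using closed nc_top_NC refines_nc_top sub \<open>0 < m\<close> by blast
  have ne: "c \<noteq> []" using bot by auto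
  have "hd c = nc_bot m"
  proof (cases c)
    case (Cons x xs)
    then have "x = nc_bot m \<or> refines {1..m} x (nc_bot m)" using bot sorted by auto
    then show ?thesis using Cons sub nc_bot_refines[of x m] refines_asym by fastforce
  qed (use ne in simp)
  moreover have "last c = nc_top m"
  proof (cases c rule: rev_cases)
    case (snoc xs x)
    then have "x = nc_top m \<or> refines {1..m} (nc_top m) x"
      using top sorted by (auto simp: sorted_wrt_append)
    then show ?thesis using snoc sub refines_nc_top[OF \<open>0 < m\<close>, of x] refines_asym by fastforce
  qed (use ne in simp)
  moreover have "successively (\<lambda>x y. (x, y) \<in> nc_cover m) c"
    unfolding successively_conv_nth
  proof (intro allI impI)
    fix i assume i: "Suc i < length c"
    let ?\<sigma> = "c ! i" and ?\<tau> = "c ! Suc i"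
    have NC: "?\<sigma> \<in> NC m" "?\<tau> \<in> NC m" using sub i by (auto simp: subset_iff)
    have ne: "?\<sigma> \<noteq> ?\<tau>" using dist i by (simp add: nth_eq_iff_index_eq)
    have ref: "refines {1..m} (c ! a) (c ! b)" if "a \<le> b" "b < length c" for a b
    proof (cases "a = b")
      case True
      have "c ! b \<in> NC m" using sub that(2) by (simp add: subset_iff)
      then show ?thesis using True refines_refl NC_partition_on by blast
    next
      case False
      then show ?thesis using sorted_wrt_nth_less[OF sorted, of a b] that by simp
    qed
    obtain \<rho> B1 B2 where \<rho>: "merges ?\<sigma> \<rho> B1 B2" "\<rho> \<in> NC m" "refines {1..m} \<rho> ?\<tau>"
      using merge_below[OF NC ref ne] i by auto
    have cov: "(?\<sigma>, \<rho>) \<in> nc_cover m" using NC \<rho> by (auto simp: nc_cover_def)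
    note \<sigma>\<rho> = nc_cover_refines[OF cov]
    have cmp: "(j \<le> i \<longrightarrow> refines {1..m} (c ! j) \<rho>) \<and> (Suc i \<le> j \<longrightarrow> refines {1..m} \<rho> (c ! j))"
      if "j < length c" for j
      using refines_trans[OF ref \<sigma>\<rho>, of j] refines_trans[OF \<rho>(3) ref, of j] i that by simp
    have "\<rho> \<in> set c"
    proof (rule closed[OF \<rho>(2)])
      fix x assume "x \<in> set c"
      then obtain j where j: "j < length c" "x = c ! j" by (auto simp: in_set_conv_nth)
      then show "refines {1..m} x \<rho> \<or> refines {1..m} \<rho> x" using cmp[of j] by (cases "j \<le> i") auto
    qed
    then obtain j where j: "j < length c" "\<rho> = c ! j" by (auto simp: in_set_conv_nth)
    have "\<rho> = ?\<tau>"
    proof (cases "j \<le> i")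
      case True
      then have "refines {1..m} \<rho> ?\<sigma>" using ref[of j i] j i by simp
      then have "\<rho> = ?\<sigma>" using \<sigma>\<rho> refines_asym by metis
      then show ?thesis using nc_cover_card[OF cov] by simp
    next
      case False
      then have "refines {1..m} ?\<tau> \<rho>" using ref[of "Suc i" j] j by simp
      then show ?thesis using \<rho>(3) refines_asym by metis
    qed
    then show "(?\<sigma>, ?\<tau>) \<in> nc_cover m" using cov by simp
  qed
  ultimately show ?thesis using ne by (simp add: paths_def)
qed

section \<open>Labels of maximal chains\<close>

lemma rtrancl_imp_path:
  assumes "(x, y) \<in> R\<^sup>*"
  shows "\<exists>c. c \<in> paths R x y"
  using assms
proof (induction rule: converse_rtrancl_induct)
  case base
  have "[y] \<in> paths R y y" by (simp add: paths_def)
  then show ?case by blast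
next
  case (step x z)
  then obtain c where "c \<in> paths R z y" by blast
  with step.hyps have "x # c \<in> paths R x y" by (auto simp: paths_def successively_Cons)
  then show ?case by blast
qed

lemma path_vertex:
  "c \<in> paths R a b \<Longrightarrow> z \<in> set c \<Longrightarrow> (a, z) \<in> R\<^sup>* \<and> (z, b) \<in> R\<^sup>*"
proof (induction c arbitrary: a z)
  case (Cons x c)
  show ?case
  proof (cases c)
    case Nil
    then show ?thesis using Cons.prems by (auto simp: paths_def)
  next
    case (Cons y d)
    then have "c \<in> paths R y b" "(x, y) \<in> R" "x = a"
      using Cons.prems by (auto simp: paths_def)
    then have "(a, z') \<in> R\<^sup>* \<and> (z', b) \<in> R\<^sup>*" if "z' \<in> set c" for z'
      using Cons.IH[of y z'] that by (meson converse_rtrancl_into_rtrancl)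
    moreover have "(a, b) \<in> R\<^sup>*"
      using Cons.IH[of y y] \<open>c \<in> paths R y b\<close> \<open>(x, y) \<in> R\<close> \<open>x = a\<close> Cons
      by (auto intro: converse_rtrancl_into_rtrancl)
    ultimately show ?thesis using Cons.prems(2) \<open>x = a\<close> by auto
  qed
qed (simp add: paths_def)

lemma path_edge:
  assumes c: "c \<in> paths R a b" and e: "(x, y) \<in> set (zip c (tl c))"
  shows "(a, x) \<in> R\<^sup>* \<and> (x, y) \<in> R \<and> (y, b) \<in> R\<^sup>*"
proof -
  obtain i where i: "i < length (tl c)" "x = c ! i" "y = tl c ! i"
    using e by (auto simp: set_zip)
  have y: "y = c ! Suc i" using i by (simp add: nth_tl)
  have "(x, y) \<in> R"
    using c i y successively_nth[of "\<lambda>x y. (x, y) \<in> R" c i] by (simp add: paths_def)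
  moreover have "x \<in> set c" "y \<in> set c" unfolding i(2) y by (rule nth_mem, use i(1) in simp)+
  ultimately show ?thesis using path_vertex[OF c] by blast
qed

lemma edge_on_path:
  assumes "(a, x) \<in> R\<^sup>*" "(x, y) \<in> R" "(y, b) \<in> R\<^sup>*"
  obtains c where "c \<in> paths R a b" "(x, y) \<in> set (zip c (tl c))"
proof -
  obtain c d where c: "c \<in> paths R a x" and d: "d \<in> paths R y b"
    using rtrancl_imp_path assms by metis
  have "c @ d \<in> paths R a b"
    using c d assms(2) by (auto simp: paths_def successively_append_iff)
  moreover have "(x, y) \<in> set (zip (c @ d) (tl (c @ d)))"
  proof -
    have *: "(x, y) \<in> set (zip (c' @ x # y # d') (tl (c' @ x # y # d')))" for c' d'
      unfolding in_set_zip by (rule exI[of _ "length c'"]) (simp add: nth_append nth_tl)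
    have "butlast c @ [x] = c" "y # tl d = d"
      using c d append_butlast_last_id[of c] list.collapse[of d] by (simp_all add: paths_def)
    then have "butlast c @ x # y # tl d = c @ d" by (metis append.assoc append_Cons append_Nil)
    then show ?thesis using *[of "butlast c" "tl d"] by simp
  qed
  ultimately show ?thesis using that[of "c @ d"] by simp
qed

lemma vertex_on_path:
  assumes "(a, x) \<in> R\<^sup>*" "(x, b) \<in> R\<^sup>*"
  obtains c where "c \<in> paths R a b" "x \<in> set c"
proof -
  obtain c d where c: "c \<in> paths R a x" and d: "d \<in> paths R x b"
    using rtrancl_imp_path assms by metis
  define d' where "d' = tl d"
  have d': "d = x # d'"
    using d list.collapse[of d] by (simp add: paths_def d'_def)
  have "c @ d' \<in> paths R a b"
    using c d unfolding d' by (cases d') (auto simp: paths_def successively_append_iff)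
  moreover have "x \<in> set c" using c by (auto simp: paths_def)
  ultimately show ?thesis using that[of "c @ d'"] by simp
qed

definition path_order :: "'a rel \<Rightarrow> 'a \<Rightarrow> 'a \<Rightarrow> 'a rel" where
  "path_order R a b = {(x, y). (a, x) \<in> R\<^sup>* \<and> (x, y) \<in> R\<^sup>* \<and> (y, b) \<in> R\<^sup>*}"

text \<open>An edge whose ends are reachable from a and lead to b extends to a full path, so every
  route between two such vertices uses only edges of full paths. This is where the generated order
  of \<open>Poset\<close> becomes reachability.\<close>

lemma Restr_paths_eq_path_order:
  "Restr ((\<Union>c\<in>paths R a b. set (zip c (tl c)))\<^sup>*) (\<Union>c\<in>paths R a b. set c) = path_order R a b"
proof -
  have V: "(\<Union>c\<in>paths R a b. set c) = {x. (a, x) \<in> R\<^sup>* \<and> (x, b) \<in> R\<^sup>*}"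
    using path_vertex[of _ R a b] by (auto elim: vertex_on_path)
  define U where "U = (\<Union>c\<in>paths R a b. set (zip c (tl c)))"
  have U: "(x, y) \<in> U \<longleftrightarrow> (a, x) \<in> R\<^sup>* \<and> (x, y) \<in> R \<and> (y, b) \<in> R\<^sup>*" for x y
    unfolding U_def using path_edge[of _ R a b x y] by (auto elim: edge_on_path[of a x R y b])
  have "U\<^sup>* \<subseteq> R\<^sup>*" by (rule rtrancl_mono) (auto simp: U)
  moreover have "(x, y) \<in> U\<^sup>*" if "(x, y) \<in> R\<^sup>*" "(a, x) \<in> R\<^sup>*" "(y, b) \<in> R\<^sup>*" for x y
    using that
  proof (induction rule: rtrancl_induct)
    case (step y z)
    have "(y, b) \<in> R\<^sup>*" using step by (meson converse_rtrancl_into_rtrancl)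
    moreover have "(a, y) \<in> R\<^sup>*" using step by (meson rtrancl_trans)
    ultimately have "(y, z) \<in> U" "(x, y) \<in> U\<^sup>*" using step U by blast+
    then show ?case by (rule rtrancl_into_rtrancl[rotated])
  qed simp
  ultimately show ?thesis
    unfolding V U_def[symmetric] path_order_def
    by (auto intro: rtrancl_trans)
qed

text \<open>When a cover merges \<open>B2\<close> into \<open>B1\<close>, exactly \<open>Min B2\<close> stops being the minimum of a block.
  Along a maximal chain this happens to each of \<open>2, \<dots>, n + 1\<close> once, which turns the labels into a
  function \<open>x \<mapsto> l x < x\<close>.\<close>

definition absorbed :: "nat set set \<Rightarrow> nat set set \<Rightarrow> nat" where
  "absorbed \<sigma> \<tau> = the_elem (Min ` \<sigma> - Min ` \<tau>)"

lemma Min_diff_merges: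
  assumes "partition_on {1..m} \<sigma>" "merges \<sigma> \<tau> B1 B2"
  shows "Min ` \<sigma> - Min ` \<tau> = {Min B2}"
  using mergesD(8)[OF assms] assms(2) by (auto simp: merges_def)

lemma absorbed_eq:
  assumes "partition_on {1..m} \<sigma>" "merges \<sigma> \<tau> B1 B2"
  shows "absorbed \<sigma> \<tau> = Min B2"
  by (simp add: absorbed_def Min_diff_merges[OF assms])

lemma nc_cover_absorbed:
  assumes "(\<sigma>, \<tau>) \<in> nc_cover m"
  shows "Min ` \<sigma> = insert (absorbed \<sigma> \<tau>) (Min ` \<tau>)" "absorbed \<sigma> \<tau> \<notin> Min ` \<tau>"
    "0 < cover_label \<sigma> \<tau>" "cover_label \<sigma> \<tau> < absorbed \<sigma> \<tau>"
proof -
  obtain B1 B2 where P: "partition_on {1..m} \<sigma>" and M: "merges \<sigma> \<tau> B1 B2"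
    using nc_coverE[OF assms] .
  have "B2 \<in> \<sigma>" using M by (simp add: merges_def)
  then show "Min ` \<sigma> = insert (absorbed \<sigma> \<tau>) (Min ` \<tau>)" "absorbed \<sigma> \<tau> \<notin> Min ` \<tau>"
    using mergesD(8)[OF P M] unfolding absorbed_eq[OF P M] by auto
  show "0 < cover_label \<sigma> \<tau>" "cover_label \<sigma> \<tau> < absorbed \<sigma> \<tau>"
    using cover_label_bounds[OF P M] unfolding absorbed_eq[OF P M] by auto
qed

lemma absorbed_path:
  assumes "successively (\<lambda>x y. (x, y) \<in> nc_cover m) c" "c \<noteq> []"
  shows "distinct (map2 absorbed c (tl c))
    \<and> set (map2 absorbed c (tl c)) \<inter> Min ` last c = {}
    \<and> Min ` hd c = set (map2 absorbed c (tl c)) \<union> Min ` last c"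
  using assms
proof (induction c rule: induct_list012)
  case (3 x y zs)
  then have IH: "distinct (map2 absorbed (y # zs) zs)"
    "set (map2 absorbed (y # zs) zs) \<inter> Min ` last (y # zs) = {}"
    "Min ` y = set (map2 absorbed (y # zs) zs) \<union> Min ` last (y # zs)"
    and xy: "(x, y) \<in> nc_cover m"
    by simp_all
  have eq: "map2 absorbed (x # y # zs) (tl (x # y # zs)) = absorbed x y # map2 absorbed (y # zs) zs"
    "last (x # y # zs) = last (y # zs)" "hd (x # y # zs) = x"
    by simp_all
  show ?case
    unfolding eq using nc_cover_absorbed(1,2)[OF xy] IH by auto
qed simp_all

section \<open>Parking functions as labels lying below the points they belong to\<close>

lemma sort_nth_le:
  fixes a :: "nat list"
  assumes "i < length a" "i < length (filter (\<lambda>x. x \<le> b) a)"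
  shows "sort a ! i \<le> b"
proof (rule ccontr)
  assume "\<not> sort a ! i \<le> b"
  then have "\<not> sort a ! j \<le> b" if "i \<le> j" "j < length a" for j
    using sorted_nth_mono[of "sort a" i j] that by simp
  then have "{j. j < length (sort a) \<and> sort a ! j \<le> b} \<subseteq> {..<i}"
    by (auto simp: not_le[symmetric])
  then have "card {j. j < length (sort a) \<and> sort a ! j \<le> b} \<le> card {..<i}"
    by (intro card_mono) auto
  then have "length (filter (\<lambda>x. x \<le> b) (sort a)) \<le> i"
    unfolding length_filter_conv_card by simp
  then show False using assms(2) by (simp add: filter_sort)
qed

text \<open>With i counted from 0, each of the i + 1 points 2, ..., i + 2 carries a label of at most
  i + 1. So at least i + 1 labels are that small, which is the parking condition at i.\<close>

lemma decreasing_labels_parking: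
  assumes len: "length ls = n" "length xs = n"
    and lx: "\<And>i. i < n \<Longrightarrow> 0 < ls ! i \<and> ls ! i < xs ! i"
    and xs: "distinct xs" "set xs = {2..Suc n}"
  shows "ls \<in> parking_functions n"
proof -
  have "sort ls ! i \<le> Suc i" if i: "i < n" for i
  proof (rule sort_nth_le)
    have "{2..Suc (Suc i)} \<subseteq> (\<lambda>j. xs ! j) ` {j. j < n \<and> ls ! j \<le> Suc i}"
    proof
      fix x assume x: "x \<in> {2..Suc (Suc i)}"
      then have "x \<in> set xs" using xs i by auto
      then obtain j where "j < n" "xs ! j = x" using len by (auto simp: in_set_conv_nth)
      then show "x \<in> (\<lambda>j. xs ! j) ` {j. j < n \<and> ls ! j \<le> Suc i}" using lx[of j] x by auto
    qed
    then have "card {2..Suc (Suc i)} \<le> card {j. j < n \<and> ls ! j \<le> Suc i}"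
      by (rule surj_card_le[rotated]) simp
    then show "i < length (filter (\<lambda>x. x \<le> Suc i) ls)"
      using len by (simp add: length_filter_conv_card)
  qed (use i len in simp)
  then show ?thesis
    using lx len by (auto simp: parking_functions_def in_set_conv_nth)
qed

text \<open>For x > k + 1 the label x - 1 has to occur, and only at a point y with x \<le> y. If x <
  y, then y already has the label y - 1, which is too large; hence y = x.\<close>

lemma decreasing_labels_PF_iff:
  assumes len: "length ls = n" "length xs = n"
    and lx: "\<And>i. i < n \<Longrightarrow> 0 < ls ! i \<and> ls ! i < xs ! i"
    and xs: "distinct xs" "set xs = {2..Suc n}" and "0 < k" "k \<le> n"
  shows "ls \<in> PF n k \<longleftrightarrow> (\<forall>i<n. if xs ! i \<le> Suc k then ls ! i \<noteq> k else xs ! i = Suc (ls ! i))"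
proof
  assume "ls \<in> PF n k"
  then have k: "k \<notin> set ls" and sub: "{k+1..n} \<subseteq> set ls" by (auto simp: PF_def)
  have "xs ! i = Suc (ls ! i)" if "i < n" "Suc k < xs ! i" for i
    using that
  \<comment> \<open>The measure makes the induction run from the point n + 1 downwards.\<close>
  proof (induction "Suc n - xs ! i" arbitrary: i rule: less_induct)
    case less
    have "xs ! i \<in> set xs" using less.prems len by simp
    then have "xs ! i - 1 \<in> {k+1..n}" using less.prems xs(2) by auto
    then have "xs ! i - 1 \<in> set ls" using sub by blast
    then obtain j where j: "j < n" "ls ! j = xs ! i - 1" using len by (auto simp: in_set_conv_nth)
    have "xs ! j \<in> set xs" using j len by simp
    then have "xs ! j \<le> Suc n" using xs(2) by auto
    have "xs ! i \<le> xs ! j" using lx[OF j(1)] j(2) by linarith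
    have "\<not> xs ! i < xs ! j"
    proof
      assume *: "xs ! i < xs ! j"
      then have "xs ! j = Suc (ls ! j)"
        using less j \<open>xs ! j \<le> Suc n\<close> by (intro less.hyps) auto
      then show False using * j less.prems by simp
    qed
    then have "xs ! i = xs ! j" using \<open>xs ! i \<le> xs ! j\<close> by simp
    then have "i = j" using xs(1) len less.prems(1) j(1) by (simp add: nth_eq_iff_index_eq)
    then show ?case using j less.prems by simp
  qed
  moreover have "ls ! i \<noteq> k" if "i < n" for i using k that len nth_mem by metis
  ultimately show "\<forall>i<n. if xs ! i \<le> Suc k then ls ! i \<noteq> k else xs ! i = Suc (ls ! i)"
    by (auto simp: not_le)
next
  assume r: "\<forall>i<n. if xs ! i \<le> Suc k then ls ! i \<noteq> k else xs ! i = Suc (ls ! i)"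
  have "k \<notin> set ls"
  proof
    assume "k \<in> set ls"
    then obtain i where "i < n" "ls ! i = k" using len by (auto simp: in_set_conv_nth)
    then show False using r by (auto split: if_splits)
  qed
  moreover have "{k+1..n} \<subseteq> set ls"
  proof
    fix j assume j: "j \<in> {k+1..n}"
    then have "Suc j \<in> set xs" using xs(2) by auto
    then obtain i where i: "i < n" "xs ! i = Suc j" using len by (auto simp: in_set_conv_nth)
    then have "ls ! i = j" using r j by auto
    then show "j \<in> set ls" using i len nth_mem by metis
  qed
  ultimately show "ls \<in> PF n k"
    using decreasing_labels_parking[OF len lx xs] by (simp add: PF_def)
qed

text \<open>This is the condition on label sequences read off a single step. What the first branch
  excludes is that k + 1 is absorbed with label k.\<close>

definition PF_cover :: "nat \<Rightarrow> nat \<Rightarrow> nat set set rel" where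
  "PF_cover n k = {(\<sigma>, \<tau>) \<in> nc_cover (Suc n).
     if absorbed \<sigma> \<tau> \<le> Suc k then cover_label \<sigma> \<tau> \<noteq> k else absorbed \<sigma> \<tau> = Suc (cover_label \<sigma> \<tau>)}"

lemma chains_of_PF:
  assumes "0 < k" "k \<le> n"
  shows "chains_of n (PF n k) = paths (PF_cover n k) (nc_bot (Suc n)) (nc_top (Suc n))"
proof -
  let ?P = "paths (nc_cover (Suc n)) (nc_bot (Suc n)) (nc_top (Suc n))"
  have "chain_labels c \<in> PF n k \<longleftrightarrow> successively (\<lambda>x y. (x, y) \<in> PF_cover n k) c"
    if c: "c \<in> ?P" for c
  proof -
    have ne: "c \<noteq> []" and suc: "successively (\<lambda>x y. (x, y) \<in> nc_cover (Suc n)) c"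
      and ends: "hd c = nc_bot (Suc n)" "last c = nc_top (Suc n)"
      using c by (auto simp: paths_def)
    \<comment> \<open>All of 1, ..., n + 1 are block minima at the bottom and only 1 is at the top,
      so this list enumerates 2, ..., n + 1 without repetition.\<close>
    define xs where "xs = map2 absorbed c (tl c)"
    have abs: "distinct xs" "set xs \<inter> {1} = {}" "{1..Suc n} = set xs \<union> {1}"
      using absorbed_path[OF suc ne] unfolding xs_def ends by (simp_all add: Min_nc_bot Min_nc_top)
    then have "set xs = {1..Suc n} - {1}" by blast
    also have "\<dots> = {2..Suc n}" by auto
    finally have set: "set xs = {2..Suc n}" .
    have lenx: "length xs = n" using distinct_card[OF abs(1)] set by simp
    then have lenc: "length c = Suc n" using ne by (auto simp: xs_def)
    have lenl: "length (chain_labels c) = n" using lenc by (simp add: chain_labels_def)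
    have nth: "chain_labels c ! i = cover_label (c ! i) (c ! Suc i)" "xs ! i = absorbed (c ! i) (c ! Suc i)"
      "(c ! i, c ! Suc i) \<in> nc_cover (Suc n)" if "i < n" for i
      using that lenc successively_nth[OF suc, of i] by (simp_all add: chain_labels_def xs_def nth_tl)
    have lx: "0 < chain_labels c ! i \<and> chain_labels c ! i < xs ! i" if "i < n" for i
      using nc_cover_absorbed(3,4)[OF nth(3)[OF that]] nth[OF that] by simp
    have "chain_labels c \<in> PF n k \<longleftrightarrow>
        (\<forall>i<n. if xs ! i \<le> Suc k then chain_labels c ! i \<noteq> k else xs ! i = Suc (chain_labels c ! i))"
      by (rule decreasing_labels_PF_iff[OF lenl lenx _ abs(1) set assms]) (rule lx)
    also have "\<dots> \<longleftrightarrow> (\<forall>i<n. (c ! i, c ! Suc i) \<in> PF_cover n k)"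
      using nth by (auto simp: PF_cover_def)
    finally show ?thesis unfolding successively_conv_nth lenc by simp
  qed
  moreover have "successively (\<lambda>x y. (x, y) \<in> nc_cover (Suc n)) c"
    if "successively (\<lambda>x y. (x, y) \<in> PF_cover n k) c" for c
    using that by (rule successively_mono) (auto simp: PF_cover_def)
  ultimately have "c \<in> ?P \<and> chain_labels c \<in> PF n k
      \<longleftrightarrow> c \<in> paths (PF_cover n k) (nc_bot (Suc n)) (nc_top (Suc n))" for c
    unfolding paths_def by blast
  moreover have "nc_maximal_chain (Suc n) c \<longleftrightarrow> c \<in> ?P" for c
    using path_is_maximal_chain maximal_chain_is_path zero_less_Suc by metis
  ultimately show ?thesis by (auto simp: chains_of_def)
qed

definition PF_order :: "nat \<Rightarrow> nat \<Rightarrow> nat set set rel" where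
  "PF_order n k = path_order (PF_cover n k) (nc_bot (Suc n)) (nc_top (Suc n))"

lemma Poset_PF:
  assumes "0 < k" "k \<le> n"
  shows "Poset n (PF n k) = PF_order n k"
  unfolding Poset_def chains_of_PF[OF assms] Restr_paths_eq_path_order PF_order_def ..

section \<open>Adding a last point\<close>

text \<open>A step of \<open>PF_cover\<close> absorbs \<open>x > k + 1\<close> only into the block of \<open>x - 1\<close>. Hence in each
  partition on these paths the point \<open>x\<close> either is still the minimum of its block or lies in the
  block of \<open>x - 1\<close>; \<open>extend\<close> adds the new last point \<open>m + 1\<close> in one of these two ways.\<close>

definition grow :: "nat \<Rightarrow> bool \<Rightarrow> nat set \<Rightarrow> nat set" where
  "grow m b B = (if b \<and> m \<in> B then insert (Suc m) B else B)"

definition extend :: "nat \<Rightarrow> bool \<Rightarrow> nat set set \<Rightarrow> nat set set" where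
  "extend m b \<sigma> = grow m b ` \<sigma> \<union> (if b then {} else {{Suc m}})"

lemma grow_False [simp]: "grow m False B = B"
  by (simp add: grow_def)

lemma grow_Int: "B \<subseteq> {1..m} \<Longrightarrow> grow m b B \<inter> {1..m} = B"
  by (auto simp: grow_def)

lemma grow_Un: "grow m b (B \<union> C) = grow m b B \<union> grow m b C"
  by (auto simp: grow_def)

lemma grow_eq_iff: "B \<subseteq> {1..m} \<Longrightarrow> C \<subseteq> {1..m} \<Longrightarrow> grow m b B = grow m b C \<longleftrightarrow> B = C"
  using grow_Int by metis

lemma grow_subset: "B \<subseteq> {1..m} \<Longrightarrow> grow m b B \<subseteq> {1..Suc m}" "B \<subseteq> grow m b B"
  by (auto simp: grow_def)

lemma Min_grow:
  assumes "B \<subseteq> {1..m}" "B \<noteq> {}"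
  shows "Min (grow m b B) = Min B"
proof -
  have fin: "finite B" by (rule finite_subset[OF assms(1)]) simp
  then have "Min B \<in> B" using assms by simp
  then have "Min B \<le> m" using assms by auto
  then show ?thesis using fin assms by (simp add: grow_def)
qed

lemma grow_neq_singleton: "B \<subseteq> {1..m} \<Longrightarrow> B \<noteq> {} \<Longrightarrow> grow m b B \<noteq> {Suc m}"
  using grow_Int[of B m b] by auto

lemma singleton_mem_extend:
  assumes "partition_on {1..m} \<sigma>"
  shows "{Suc m} \<in> extend m b \<sigma> \<longleftrightarrow> \<not> b"
proof -
  have "{Suc m} \<notin> grow m b ` \<sigma>"
    using grow_neq_singleton partition_on_block(1,2)[OF assms] by (metis imageE)
  then show ?thesis by (simp add: extend_def)
qed

lemma extend_inj:
  assumes \<sigma>: "partition_on {1..m} \<sigma>" and \<tau>: "partition_on {1..m} \<tau>"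
    and eq: "extend m b \<sigma> = extend m c \<tau>"
  shows "b = c \<and> \<sigma> = \<tau>"
proof -
  \<comment> \<open>Forgetting the last point recovers the partition: the blocks are cut back to
    \<open>{1..m}\<close>, and what remains of the singleton \<open>{Suc m}\<close> is the empty
    set, which is removed.\<close>
  have *: "(\<lambda>B. B \<inter> {1..m}) ` extend m b \<rho> - {{}} = \<rho>" if \<rho>: "partition_on {1..m} \<rho>" for b \<rho>
  proof -
    have "(\<lambda>B. B \<inter> {1..m}) ` grow m b ` \<rho> = \<rho>"
      unfolding image_image using grow_Int partition_on_block(2)[OF \<rho>] by simp
    then show ?thesis using partition_onD3[OF \<rho>] unfolding extend_def image_Un by auto
  qed
  have "b = c" using singleton_mem_extend[OF \<sigma>, of b] singleton_mem_extend[OF \<tau>, of c] eq by simp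
  moreover have "\<sigma> = (\<lambda>B. B \<inter> {1..m}) ` extend m c \<tau> - {{}}"
    unfolding eq[symmetric] by (rule *[OF \<sigma>, symmetric])
  ultimately show ?thesis unfolding *[OF \<tau>] by blast
qed

lemma partition_on_extend:
  assumes "0 < m" and P: "partition_on {1..m} \<sigma>"
  shows "partition_on {1..Suc m} (extend m b \<sigma>)"
proof (rule partition_onI)
  note bl = partition_on_block(1,2)[OF P]
  have U: "\<Union>\<sigma> = {1..m}" using partition_onD1[OF P] by simp
  obtain M where M: "M \<in> \<sigma>" "m \<in> M"
    by (rule partition_on_obtain_block[OF P, of m]) (use assms(1) in auto)
  have Ug: "\<Union>(grow m b ` \<sigma>) = (if b then insert (Suc m) (\<Union>\<sigma>) else \<Union>\<sigma>)"
    using M by (auto simp: grow_def)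
  show "\<Union>(extend m b \<sigma>) = {1..Suc m}"
    unfolding extend_def Union_Un_distrib Ug U by auto
  show "{} \<notin> extend m b \<sigma>" using bl unfolding extend_def by (auto simp: grow_def)
  have g: "disjnt (grow m b B) (grow m b C)" if BC: "B \<in> \<sigma>" "C \<in> \<sigma>" "B \<noteq> C" for B C
  proof -
    have "disjnt B C" using pairwiseD[OF partition_onD2[OF P] BC] .
    moreover have "Suc m \<notin> B" "Suc m \<notin> C" using bl(2)[OF BC(1)] bl(2)[OF BC(2)] by auto
    ultimately show ?thesis by (auto simp: grow_def disjnt_iff)
  qed
  have s: "disjnt B {Suc m}" if "B \<in> \<sigma>" for B using bl(2)[OF that] by auto
  fix p q assume pq: "p \<in> extend m b \<sigma>" "q \<in> extend m b \<sigma>" "p \<noteq> q"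
  show "disjnt p q"
  proof (cases b)
    case True
    then obtain B C where "B \<in> \<sigma>" "C \<in> \<sigma>" "p = grow m b B" "q = grow m b C"
      using pq by (auto simp: extend_def)
    then show ?thesis using g pq(3) by blast
  next
    case False
    then have "p = {Suc m} \<or> p \<in> \<sigma>" "q = {Suc m} \<or> q \<in> \<sigma>" using pq by (auto simp: extend_def)
    then show ?thesis
      using s[of p] s[of q] g[of p q] pq(3) False by (auto simp: disjnt_sym)
  qed
qed

text \<open>In a crossing of the grown blocks the new point can only be the largest of the four. Its
  block also contains m, and m can take its place: the third point belongs to the other block, so it
  is below m.\<close>

lemma cross_grow:
  assumes BC: "B \<subseteq> {1..m}" "C \<subseteq> {1..m}" "disjnt B C" and cr: "cross (grow m b B) (grow m b C)"
  shows "cross B C"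
proof -
  obtain w x y z where w: "w < x" "x < y" "y < z"
    "w \<in> grow m b B \<and> y \<in> grow m b B \<and> x \<in> grow m b C \<and> z \<in> grow m b C \<or>
     w \<in> grow m b C \<and> y \<in> grow m b C \<and> x \<in> grow m b B \<and> z \<in> grow m b B"
    using cr by (rule cross_cases)
  have lt: "v \<in> B'" if "v \<in> grow m b B'" "v < Suc m" for v B'
    using that by (auto simp: grow_def split: if_splits)
  have cr': "cross B' C'" if B: "B' \<subseteq> {1..m}" "C' \<subseteq> {1..m}" "disjnt B' C'"
    and g: "w \<in> grow m b B'" "y \<in> grow m b B'" "x \<in> grow m b C'" "z \<in> grow m b C'" for B' C'
  proof -
    have "z \<le> Suc m" using grow_subset(1)[OF B(2), of b] g(4) by auto
    then have mem: "w \<in> B'" "x \<in> C'" "y \<in> B'" using w by (auto intro: lt g)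
    show ?thesis
    proof (cases "z \<in> C'")
      case True
      then show ?thesis using mem w crossI[of w B' y x C' z] by simp
    next
      case False
      then have "z = Suc m" "m \<in> C'" using g(4) by (auto simp: grow_def split: if_splits)
      moreover have "y \<noteq> m" using mem \<open>m \<in> C'\<close> B(3) by (auto simp: disjnt_iff)
      ultimately show ?thesis using mem w crossI[of w B' y x C' m] by simp
    qed
  qed
  show ?thesis using w(4) cr'[of B C] cr'[of C B] BC cross_sym disjnt_sym by blast
qed

lemma extend_NC_iff:
  assumes "0 < m" and P: "partition_on {1..m} \<sigma>"
  shows "extend m b \<sigma> \<in> NC (Suc m) \<longleftrightarrow> \<sigma> \<in> NC m"
proof
  note bl = partition_on_block(1,2)[OF P]
  assume e: "extend m b \<sigma> \<in> NC (Suc m)"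
  have "\<not> cross B C" if BC: "B \<in> \<sigma>" "C \<in> \<sigma>" "B \<noteq> C" for B C
  proof
    assume "cross B C"
    then have "cross (grow m b B) (grow m b C)" by (rule cross_mono) (rule grow_subset)+
    moreover have "grow m b B \<noteq> grow m b C"
      using grow_eq_iff[OF bl(2)[OF BC(1)] bl(2)[OF BC(2)]] BC(3) by simp
    moreover have "grow m b B \<in> extend m b \<sigma>" "grow m b C \<in> extend m b \<sigma>"
      using BC by (auto simp: extend_def)
    ultimately show False using e unfolding mem_NC_iff by blast
  qed
  then show "\<sigma> \<in> NC m" using P by (simp add: mem_NC_iff)
next
  note bl = partition_on_block(1,2)[OF P]
  assume s: "\<sigma> \<in> NC m"
  have "\<not> cross p q" if pq: "p \<in> extend m b \<sigma>" "q \<in> extend m b \<sigma>" "p \<noteq> q" for p q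
  proof -
    consider "p = {Suc m}" | "q = {Suc m}"
      | B C where "B \<in> \<sigma>" "C \<in> \<sigma>" "p = grow m b B" "q = grow m b C"
      using pq unfolding extend_def by (auto split: if_splits)
    then show ?thesis
    proof cases
      case 3
      then have "B \<noteq> C" using pq by blast
      then have "\<not> cross B C" "disjnt B C"
        using s 3 pairwiseD[OF partition_onD2[OF P] 3(1,2)] unfolding mem_NC_iff by blast+
      then show ?thesis using 3 cross_grow[OF bl(2)[OF 3(1)] bl(2)[OF 3(2)]] by blast
    qed (simp_all add: not_cross_singleton)
  qed
  then show "extend m b \<sigma> \<in> NC (Suc m)"
    using partition_on_extend[OF assms] by (simp add: mem_NC_iff)
qed

text \<open>Growing is injective on blocks, commutes with unions and keeps minima, so a merge of two
  grown blocks is the extension of a merge. Merges involving the new singleton are not of this form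
  and are treated apart.\<close>

lemma merges_extend_iff:
  assumes P: "partition_on {1..m} \<sigma>" and B: "B1 \<in> \<sigma>" "B2 \<in> \<sigma>"
  shows "merges (extend m b \<sigma>) \<tau>' (grow m b B1) (grow m b B2)
    \<longleftrightarrow> (\<exists>\<tau>. merges \<sigma> \<tau> B1 B2 \<and> \<tau>' = extend m b \<tau>)"
proof -
  note bl = partition_on_block(1,2)[OF P]
  have inj: "inj_on (grow m b) \<sigma>" by (rule inj_onI) (metis grow_eq_iff bl(2))
  have G: "grow m b ` (\<sigma> - {B1, B2}) = grow m b ` \<sigma> - {grow m b B1, grow m b B2}"
    using inj_on_image_set_diff[OF inj, of \<sigma> "{B1, B2}"] B by simp
  have "grow m b B1 \<noteq> {Suc m}" "grow m b B2 \<noteq> {Suc m}"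
    by (rule grow_neq_singleton[OF bl(2) bl(1)], rule B, rule B)+
  then have "insert u (H \<union> (if b then {} else {{Suc m}}) - {grow m b B1, grow m b B2})
      = insert u (H - {grow m b B1, grow m b B2}) \<union> (if b then {} else {{Suc m}})" for u H
    by (cases b) auto
  then have eq: "insert (grow m b B1 \<union> grow m b B2) (extend m b \<sigma> - {grow m b B1, grow m b B2})
      = extend m b (insert (B1 \<union> B2) (\<sigma> - {B1, B2}))"
    unfolding extend_def grow_Un[symmetric] image_insert G .
  have U: "B1 \<union> B2 \<subseteq> {1..m}" "B1 \<union> B2 \<noteq> {}" using bl B by blast+
  have mn: "Min (grow m b B1 \<union> grow m b B2) = Min (B1 \<union> B2)"
    unfolding grow_Un[symmetric] using Min_grow[OF U] .
  have "finite (B1 \<union> B2)" by (rule finite_subset[OF U(1)]) simp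
  then have "Min (B1 \<union> B2) \<in> B1 \<union> B2" using U by (intro Min_in) auto
  then have "Min (B1 \<union> B2) \<in> {1..m}" using U by blast
  then have "Min (B1 \<union> B2) \<in> grow m b B1 \<longleftrightarrow> Min (B1 \<union> B2) \<in> B1"
    using grow_Int[OF bl(2)[OF B(1)], of b] by blast
  moreover have "grow m b B1 = grow m b B2 \<longleftrightarrow> B1 = B2"
    by (rule grow_eq_iff[OF bl(2)[OF B(1)] bl(2)[OF B(2)]])
  moreover have "grow m b B1 \<in> extend m b \<sigma>" "grow m b B2 \<in> extend m b \<sigma>"
    using B by (auto simp: extend_def)
  ultimately show ?thesis unfolding merges_def mn eq using B by blast
qed

section \<open>Allowed steps between extended partitions\<close>

definition PF_merge :: "nat \<Rightarrow> nat set \<Rightarrow> nat set \<Rightarrow> bool" where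
  "PF_merge k B1 B2 \<longleftrightarrow> (if Min B2 \<le> Suc k then Max {x \<in> B1. x < Min B2} \<noteq> k
     else Min B2 = Suc (Max {x \<in> B1. x < Min B2}))"

text \<open>In terms of the two merged blocks, the step condition is free of \<open>the_elem\<close>
  and \<open>THE\<close>, so it can be compared before and after growing blocks.\<close>

lemma mem_PF_cover_iff:
  "(\<sigma>, \<tau>) \<in> PF_cover n k \<longleftrightarrow> \<sigma> \<in> NC (Suc n) \<and> \<tau> \<in> NC (Suc n)
    \<and> (\<exists>B1 B2. merges \<sigma> \<tau> B1 B2 \<and> PF_merge k B1 B2)"
proof -
  have "(if absorbed \<sigma> \<tau> \<le> Suc k then cover_label \<sigma> \<tau> \<noteq> k else absorbed \<sigma> \<tau> = Suc (cover_label \<sigma> \<tau>))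
      \<longleftrightarrow> PF_merge k B1 B2" if "\<sigma> \<in> NC (Suc n)" "merges \<sigma> \<tau> B1 B2" for B1 B2
    unfolding PF_merge_def
    unfolding absorbed_eq[OF NC_partition_on[OF that(1)] that(2)]
      cover_label_eq[OF NC_partition_on[OF that(1)] that(2)] ..
  then show ?thesis unfolding PF_cover_def nc_cover_def by blast
qed

text \<open>The new point exceeds \<open>Min B2\<close>, so it never enters the set whose maximum is
  the label.\<close>

lemma PF_merge_grow:
  assumes "B1 \<subseteq> {1..m}" "B2 \<subseteq> {1..m}" "B2 \<noteq> {}"
  shows "PF_merge k (grow m b B1) (grow m b B2) = PF_merge k B1 B2"
proof -
  have "finite B2" by (rule finite_subset[OF assms(2)]) simp
  then have "Min B2 \<in> B2" using assms by simp
  then have "{x \<in> grow m b B1. x < Min B2} = {x \<in> B1. x < Min B2}"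
    using assms by (auto simp: grow_def)
  then show ?thesis unfolding PF_merge_def Min_grow[OF assms(2,3)] by simp
qed

lemma extend_True_eq:
  assumes P: "partition_on {1..m} \<sigma>" and B: "B \<in> \<sigma>" "m \<in> B"
  shows "extend m True \<sigma> = insert (insert (Suc m) B) (\<sigma> - {B})"
proof -
  have "grow m True C = C" if "C \<in> \<sigma> - {B}" for C
    using that partition_on_eqI[OF P _ B(1) _ B(2), of C] by (auto simp: grow_def)
  then have "grow m True ` (\<sigma> - {B}) = \<sigma> - {B}" by simp
  moreover have "\<sigma> = insert B (\<sigma> - {B})" using B by blast
  ultimately have "grow m True ` \<sigma> = insert (grow m True B) (\<sigma> - {B})" by (metis image_insert)
  then show ?thesis using B by (simp add: extend_def grow_def)
qed

text \<open>Absorbing the point m + 1 into the block of m has label m, just what is demanded of a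
  point beyond k + 1.\<close>

lemma PF_cover_extend_flip:
  assumes "k < m" "\<sigma> \<in> NC m"
  shows "(extend m False \<sigma>, extend m True \<sigma>) \<in> PF_cover m k"
proof -
  have P: "partition_on {1..m} \<sigma>" using assms NC_partition_on by blast
  obtain B where B: "B \<in> \<sigma>" "m \<in> B"
    by (rule partition_on_obtain_block[OF P, of m]) (use assms(1) in auto)
  note bl = partition_on_block[OF P B(1)]
  have ext: "extend m False \<sigma> \<in> NC (Suc m)" "extend m True \<sigma> \<in> NC (Suc m)"
    using extend_NC_iff[OF _ P] assms by auto
  have nin: "{Suc m} \<notin> \<sigma>" using partition_on_block(2)[OF P, of "{Suc m}"] by auto
  have "Min (B \<union> {Suc m}) = Min B" using bl Min_grow[OF bl(2,1), of True] B by (simp add: grow_def)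
  then have "merges (extend m False \<sigma>) (extend m True \<sigma>) B {Suc m}"
    unfolding merges_def extend_True_eq[OF P B]
    using B bl nin by (auto simp: extend_def)
  moreover have "Max {x \<in> B. x < Suc m} = m"
    using bl B by (intro Max_eqI) auto
  then have "PF_merge k B {Suc m}" using assms by (simp add: PF_merge_def)
  ultimately show ?thesis using ext unfolding mem_PF_cover_iff by blast
qed

lemma PF_cover_extend:
  assumes "(\<sigma>, \<tau>) \<in> PF_cover n k"
  shows "(extend (Suc n) b \<sigma>, extend (Suc n) b \<tau>) \<in> PF_cover (Suc n) k"
proof -
  obtain B1 B2 where NC: "\<sigma> \<in> NC (Suc n)" "\<tau> \<in> NC (Suc n)" and M: "merges \<sigma> \<tau> B1 B2"
    and g: "PF_merge k B1 B2"
    using assms unfolding mem_PF_cover_iff by blast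
  note P = NC_partition_on[OF NC(1)]
  have B: "B1 \<in> \<sigma>" "B2 \<in> \<sigma>" using M by (auto simp: merges_def)
  have "merges (extend (Suc n) b \<sigma>) (extend (Suc n) b \<tau>) (grow (Suc n) b B1) (grow (Suc n) b B2)"
    using merges_extend_iff[OF P B] M by blast
  moreover have "PF_merge k (grow (Suc n) b B1) (grow (Suc n) b B2)"
    using PF_merge_grow[of B1 "Suc n" B2] partition_on_block[OF P] B g by blast
  ultimately show ?thesis
    using extend_NC_iff NC NC_partition_on[OF NC(1)] NC_partition_on[OF NC(2)]
    unfolding mem_PF_cover_iff by blast
qed

text \<open>An allowed step either merges two blocks that come from \<open>\<sigma>\<close>, or it
  absorbs the new singleton, and then the label condition dictates the block that absorbs
  it.\<close>

lemma PF_cover_from_extend: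
  assumes "k \<le> n" and \<sigma>: "\<sigma> \<in> NC (Suc n)" and c: "(extend (Suc n) b \<sigma>, \<tau>') \<in> PF_cover (Suc n) k"
  shows "(\<exists>\<tau>. \<tau>' = extend (Suc n) b \<tau> \<and> (\<sigma>, \<tau>) \<in> PF_cover n k)
    \<or> (\<not> b \<and> \<tau>' = extend (Suc n) True \<sigma>)"
proof -
  define m where "m = Suc n"
  have P: "partition_on {1..m} \<sigma>" using NC_partition_on[OF \<sigma>] m_def by simp
  note bl = partition_on_block[OF P]
  obtain C1 C2 where M: "merges (extend m b \<sigma>) \<tau>' C1 C2" and g: "PF_merge k C1 C2"
    and NC: "\<tau>' \<in> NC (Suc m)"
    using c unfolding mem_PF_cover_iff m_def by blast
  have C: "C1 \<in> extend m b \<sigma>" "C2 \<in> extend m b \<sigma>" "C1 \<noteq> C2" "Min (C1 \<union> C2) \<in> C1"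
    "\<tau>' = insert (C1 \<union> C2) (extend m b \<sigma> - {C1, C2})"
    using M by (auto simp: merges_def)
  consider B1 B2 where "B1 \<in> \<sigma>" "B2 \<in> \<sigma>" "C1 = grow m b B1" "C2 = grow m b B2"
    | "\<not> b" "C1 = {Suc m}" "C2 \<in> \<sigma>" | "\<not> b" "C1 \<in> \<sigma>" "C2 = {Suc m}"
    using C(1-3) unfolding extend_def by (auto split: if_splits)
  then show ?thesis
  proof cases
    case 1
    then obtain \<tau> where \<tau>: "merges \<sigma> \<tau> B1 B2" "\<tau>' = extend m b \<tau>"
      using M merges_extend_iff[OF P] by blast
    have "PF_merge k B1 B2" using g PF_merge_grow[of B1 m B2] bl 1 by blast
    moreover have "\<tau> \<in> NC m"
      using NC extend_NC_iff[OF _ mergesD(5)[OF P \<tau>(1)]] \<tau>(2) m_def by blast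
    ultimately have "(\<sigma>, \<tau>) \<in> PF_cover n k"
      using \<sigma> \<tau>(1) unfolding mem_PF_cover_iff m_def by blast
    then show ?thesis using \<tau>(2) m_def by blast
  next
    \<comment> \<open>The singleton of the largest point cannot contain the minimum of the
      union.\<close>
    case 2
    note b2 = bl[OF 2(3)]
    have "Min (C1 \<union> C2) \<le> Min C2" using b2 2 by (intro Min_antimono) auto
    moreover have "Min C2 \<le> m" using b2(2,4) by (meson atLeastAtMost_iff subsetD)
    ultimately show ?thesis using C(4) 2 by auto
  next
    case 3
    note b1 = bl[OF 3(2)]
    have nin: "{Suc m} \<notin> \<sigma>" using bl(2)[of "{Suc m}"] by auto
    have "{x \<in> C1. x < Suc m} = C1" using b1 by auto
    \<comment> \<open>By \<open>k \<le> n\<close> the absorbed point is beyond k + 1, so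
      \<open>PF_merge\<close> forces the label m and hence the block of m.\<close>
    then have "m = Max C1" using g 3(3) assms(1) by (simp add: PF_merge_def m_def)
    then have "m \<in> C1" using b1 by simp
    then have "\<tau>' = extend m True \<sigma>"
      unfolding extend_True_eq[OF P 3(2) \<open>m \<in> C1\<close>] C(5) using 3 nin by (auto simp: extend_def)
    then show ?thesis using 3 m_def by blast
  qed
qed

lemma rtrancl_PF_cover_NC:
  "(\<sigma>, \<tau>) \<in> (PF_cover n k)\<^sup>* \<Longrightarrow> \<sigma> \<in> NC (Suc n) \<Longrightarrow> \<tau> \<in> NC (Suc n)"
  by (induction rule: rtrancl_induct) (auto simp: mem_PF_cover_iff)

text \<open>Each step changes either the smaller partition or the flag, and the flag is only ever
  raised. Reachability is therefore the product of reachability below with the order False <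
  True.\<close>

lemma rtrancl_PF_cover_extend_iff:
  assumes "k \<le> n" "\<sigma> \<in> NC (Suc n)"
  shows "(extend (Suc n) b \<sigma>, \<tau>') \<in> (PF_cover (Suc n) k)\<^sup>*
    \<longleftrightarrow> (\<exists>c \<tau>. \<tau>' = extend (Suc n) c \<tau> \<and> (\<sigma>, \<tau>) \<in> (PF_cover n k)\<^sup>* \<and> (b \<longrightarrow> c))"
proof
  assume "(extend (Suc n) b \<sigma>, \<tau>') \<in> (PF_cover (Suc n) k)\<^sup>*"
  then show "\<exists>c \<tau>. \<tau>' = extend (Suc n) c \<tau> \<and> (\<sigma>, \<tau>) \<in> (PF_cover n k)\<^sup>* \<and> (b \<longrightarrow> c)"
  proof (induction rule: rtrancl_induct)
    case (step \<rho>' \<tau>')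
    then obtain c \<rho> where \<rho>: "\<rho>' = extend (Suc n) c \<rho>" "(\<sigma>, \<rho>) \<in> (PF_cover n k)\<^sup>*" "b \<longrightarrow> c"
      by blast
    have "\<rho> \<in> NC (Suc n)" using rtrancl_PF_cover_NC \<rho>(2) assms(2) by blast
    then have "(\<exists>\<tau>. \<tau>' = extend (Suc n) c \<tau> \<and> (\<rho>, \<tau>) \<in> PF_cover n k)
        \<or> (\<not> c \<and> \<tau>' = extend (Suc n) True \<rho>)"
      using PF_cover_from_extend[OF assms(1)] step.hyps(2) \<rho>(1) by blast
    then show ?case
    proof
      assume "\<exists>\<tau>. \<tau>' = extend (Suc n) c \<tau> \<and> (\<rho>, \<tau>) \<in> PF_cover n k"
      then show ?thesis using \<rho>(2,3) rtrancl_into_rtrancl[OF \<rho>(2)] by blast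
    next
      assume "\<not> c \<and> \<tau>' = extend (Suc n) True \<rho>"
      then show ?thesis using \<rho>(2) by blast
    qed
  qed blast
next
  assume "\<exists>c \<tau>. \<tau>' = extend (Suc n) c \<tau> \<and> (\<sigma>, \<tau>) \<in> (PF_cover n k)\<^sup>* \<and> (b \<longrightarrow> c)"
  then obtain c \<tau> where \<tau>: "\<tau>' = extend (Suc n) c \<tau>" "(\<sigma>, \<tau>) \<in> (PF_cover n k)\<^sup>*" "b \<longrightarrow> c"
    by blast
  \<comment> \<open>The path below is lifted with the flag held at b; the flag is raised only at its
    end.\<close>
  have "(extend (Suc n) b \<sigma>, extend (Suc n) b \<tau>) \<in> (PF_cover (Suc n) k)\<^sup>*"
    using \<tau>(2) by (induction rule: rtrancl_induct) (auto intro: PF_cover_extend rtrancl_into_rtrancl)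
  moreover have "\<tau> \<in> NC (Suc n)" using rtrancl_PF_cover_NC \<tau>(2) assms(2) by blast
  then have "(extend (Suc n) b \<tau>, extend (Suc n) c \<tau>) \<in> (PF_cover (Suc n) k)\<^sup>*"
    using PF_cover_extend_flip[of k "Suc n" \<tau>] assms(1) \<tau>(3) by (cases "b = c") auto
  ultimately show "(extend (Suc n) b \<sigma>, \<tau>') \<in> (PF_cover (Suc n) k)\<^sup>*"
    unfolding \<tau>(1) by (rule rtrancl_trans)
qed

section \<open>The order after adding one point, and after adding several\<close>

lemma extend_nc_bot: "extend m False (nc_bot m) = nc_bot (Suc m)"
  by (simp add: extend_def nc_bot_def atLeastAtMostSuc_conv)

lemma extend_nc_top: "0 < m \<Longrightarrow> extend m True (nc_top m) = nc_top (Suc m)"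
  by (simp add: extend_def nc_top_def grow_def atLeastAtMostSuc_conv)

lemma PF_order_NC: "(\<sigma>, \<tau>) \<in> PF_order n k \<Longrightarrow> \<sigma> \<in> NC (Suc n) \<and> \<tau> \<in> NC (Suc n)"
  unfolding PF_order_def path_order_def using rtrancl_PF_cover_NC nc_bot_NC by blast

text \<open>Not every noncrossing partition is an extension, but the bottom is one, with flag False,
  and steps from extensions lead to extensions. The top is the extension of the top with flag True,
  which every flag can still reach.\<close>

lemma PF_order_Suc:
  assumes "k \<le> n"
  shows "(x, y) \<in> PF_order (Suc n) k \<longleftrightarrow>
    (\<exists>b c \<sigma> \<tau>. (\<sigma>, \<tau>) \<in> PF_order n k \<and> (b \<longrightarrow> c) \<and> x = extend (Suc n) b \<sigma> \<and> y = extend (Suc n) c \<tau>)"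
proof -
  let ?e = "extend (Suc n)" and ?R = "(PF_cover n k)\<^sup>*" and ?R' = "(PF_cover (Suc n) k)\<^sup>*"
  have ends: "nc_bot (Suc (Suc n)) = ?e False (nc_bot (Suc n))"
    "nc_top (Suc (Suc n)) = ?e True (nc_top (Suc n))"
    by (simp_all add: extend_nc_bot extend_nc_top)
  have bot: "(nc_bot (Suc (Suc n)), x) \<in> ?R' \<longleftrightarrow> (\<exists>b \<sigma>. x = ?e b \<sigma> \<and> (nc_bot (Suc n), \<sigma>) \<in> ?R)" for x
    unfolding ends rtrancl_PF_cover_extend_iff[OF assms nc_bot_NC] by simp
  have step: "(?e b \<sigma>, ?e c \<tau>) \<in> ?R' \<longleftrightarrow> (\<sigma>, \<tau>) \<in> ?R \<and> (b \<longrightarrow> c)"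
    if "\<sigma> \<in> NC (Suc n)" "\<tau> \<in> NC (Suc n)" for b c \<sigma> \<tau>
    unfolding rtrancl_PF_cover_extend_iff[OF assms that(1)]
    using extend_inj[OF NC_partition_on NC_partition_on] rtrancl_PF_cover_NC that by blast
  note top = step[OF _ nc_top_NC[OF zero_less_Suc], where c = True, folded ends(2)]
  have botNC: "\<sigma> \<in> NC (Suc n)" if "(nc_bot (Suc n), \<sigma>) \<in> ?R" for \<sigma>
    using that rtrancl_PF_cover_NC nc_bot_NC by blast
  show ?thesis
  proof
    assume "(x, y) \<in> PF_order (Suc n) k"
    then have xy: "(nc_bot (Suc (Suc n)), x) \<in> ?R'" "(x, y) \<in> ?R'" "(y, nc_top (Suc (Suc n))) \<in> ?R'"
      by (auto simp: PF_order_def path_order_def)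
    then have "(nc_bot (Suc (Suc n)), y) \<in> ?R'" by (meson rtrancl_trans)
    then obtain b \<sigma> c \<tau> where eq: "x = ?e b \<sigma>" "y = ?e c \<tau>"
      and R: "(nc_bot (Suc n), \<sigma>) \<in> ?R" "(nc_bot (Suc n), \<tau>) \<in> ?R"
      using xy(1) unfolding bot by blast
    note NC = botNC[OF R(1)] botNC[OF R(2)]
    have "(\<sigma>, \<tau>) \<in> ?R" "b \<longrightarrow> c" using xy(2) step[OF NC] eq by auto
    moreover have "(\<tau>, nc_top (Suc n)) \<in> ?R" using xy(3) top[OF NC(2)] eq by simp
    ultimately show "\<exists>b c \<sigma> \<tau>. (\<sigma>, \<tau>) \<in> PF_order n k \<and> (b \<longrightarrow> c) \<and> x = ?e b \<sigma> \<and> y = ?e c \<tau>"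
      using R(1) eq unfolding PF_order_def path_order_def by blast
  next
    assume "\<exists>b c \<sigma> \<tau>. (\<sigma>, \<tau>) \<in> PF_order n k \<and> (b \<longrightarrow> c) \<and> x = ?e b \<sigma> \<and> y = ?e c \<tau>"
    then obtain b c \<sigma> \<tau> where o: "(\<sigma>, \<tau>) \<in> PF_order n k" and bc: "b \<longrightarrow> c"
      and eq: "x = ?e b \<sigma>" "y = ?e c \<tau>" by blast
    then have R: "(nc_bot (Suc n), \<sigma>) \<in> ?R" "(\<sigma>, \<tau>) \<in> ?R" "(\<tau>, nc_top (Suc n)) \<in> ?R"
      by (auto simp: PF_order_def path_order_def)
    have NC: "\<sigma> \<in> NC (Suc n)" "\<tau> \<in> NC (Suc n)" using PF_order_NC[OF o] by auto
    have "(nc_bot (Suc (Suc n)), x) \<in> ?R'" unfolding bot using eq R by blast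
    moreover have "(x, y) \<in> ?R'" using step[OF NC] R bc eq by simp
    moreover have "(y, nc_top (Suc (Suc n))) \<in> ?R'" using top[OF NC(2)] R eq by simp
    ultimately show "(x, y) \<in> PF_order (Suc n) k" by (simp add: PF_order_def path_order_def)
  qed
qed

text \<open>Starting from a partition of k + 1 points, stage j adds the point k + j + 1;
  \<open>j \<in> S\<close> means that it is attached to k + j instead of forming a
  singleton.\<close>

fun extend_many :: "nat \<Rightarrow> nat \<Rightarrow> nat set \<Rightarrow> nat set set \<Rightarrow> nat set set" where
  "extend_many k 0 S \<sigma> = \<sigma>"
| "extend_many k (Suc d) S \<sigma> = extend (Suc (k + d)) (Suc d \<in> S) (extend_many k d S \<sigma>)"

lemma extend_many_cong: "S \<inter> {1..d} = T \<inter> {1..d} \<Longrightarrow> extend_many k d S \<sigma> = extend_many k d T \<sigma>"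
proof (induction d)
  case (Suc d)
  have "X \<inter> {1..d} = (X \<inter> {1..Suc d}) \<inter> {1..d}" "Suc d \<in> X \<longleftrightarrow> Suc d \<in> X \<inter> {1..Suc d}" for X
    by auto
  then have "S \<inter> {1..d} = T \<inter> {1..d}" "Suc d \<in> S \<longleftrightarrow> Suc d \<in> T"
    using Suc.prems by metis+
  then show ?case using Suc.IH by simp
qed simp

lemma extend_many_NC: "\<sigma> \<in> NC (Suc k) \<Longrightarrow> extend_many k d S \<sigma> \<in> NC (Suc (k + d))"
  by (induction d) (simp_all add: extend_NC_iff[OF _ NC_partition_on])

lemma extend_many_inj:
  assumes "\<sigma> \<in> NC (Suc k)" "\<tau> \<in> NC (Suc k)" "extend_many k d S \<sigma> = extend_many k d T \<tau>"
  shows "\<sigma> = \<tau> \<and> S \<inter> {1..d} = T \<inter> {1..d}"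
  using assms(3)
proof (induction d)
  case (Suc d)
  have "(Suc d \<in> S) = (Suc d \<in> T) \<and> extend_many k d S \<sigma> = extend_many k d T \<tau>"
    using Suc.prems extend_inj[OF NC_partition_on NC_partition_on] extend_many_NC assms(1,2)
    by (metis extend_many.simps(2))
  then show ?case using Suc.IH by (simp add: atLeastAtMostSuc_conv Int_insert_right)
qed simp

text \<open>Each added point contributes an implication between two flags; together these
  implications say that S is contained in T.\<close>

lemma PF_order_extend_many:
  "(x, y) \<in> PF_order (k + d) k \<longleftrightarrow> (\<exists>\<sigma> \<tau> S T. (\<sigma>, \<tau>) \<in> PF_order k k \<and> (S, T) \<in> boolean_lattice d
     \<and> x = extend_many k d S \<sigma> \<and> y = extend_many k d T \<tau>)"
proof (induction d arbitrary: x y)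
  case 0
  then show ?case by (simp add: boolean_lattice_def)
next
  case (Suc d)
  let ?e = "extend (Suc (k + d))"
  show ?case
  proof
    assume "(x, y) \<in> PF_order (k + Suc d) k"
    then obtain b c x' y' where "(x', y') \<in> PF_order (k + d) k" "b \<longrightarrow> c" "x = ?e b x'" "y = ?e c y'"
      using PF_order_Suc[of k "k + d" x y] by auto
    moreover then obtain \<sigma> \<tau> S T where \<sigma>: "(\<sigma>, \<tau>) \<in> PF_order k k" and ST: "S \<subseteq> T" "T \<subseteq> {1..d}"
      and eq: "x' = extend_many k d S \<sigma>" "y' = extend_many k d T \<tau>"
      using Suc.IH by (auto simp: boolean_lattice_def)
    \<comment> \<open>The newest flag is stored as membership of \<open>Suc d\<close>, which the
      earlier stages do not inspect.\<close>
    define S' T' where "S' = (if b then insert (Suc d) S else S)"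
      and "T' = (if c then insert (Suc d) T else T)"
    have *: "S' \<inter> {1..d} = S \<inter> {1..d}" "T' \<inter> {1..d} = T \<inter> {1..d}" "Suc d \<in> S' \<longleftrightarrow> b" "Suc d \<in> T' \<longleftrightarrow> c"
      using ST by (auto simp: S'_def T'_def)
    have "?e b x' = extend_many k (Suc d) S' \<sigma>" "?e c y' = extend_many k (Suc d) T' \<tau>"
      unfolding extend_many.simps extend_many_cong[OF *(1)] extend_many_cong[OF *(2)] *(3,4) eq
      by (rule refl)+
    moreover have "(S', T') \<in> boolean_lattice (Suc d)" if "b \<longrightarrow> c"
      using ST that by (auto simp: S'_def T'_def boolean_lattice_def)
    ultimately show "\<exists>\<sigma> \<tau> S T. (\<sigma>, \<tau>) \<in> PF_order k k \<and> (S, T) \<in> boolean_lattice (Suc d)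
        \<and> x = extend_many k (Suc d) S \<sigma> \<and> y = extend_many k (Suc d) T \<tau>"
      using \<sigma> by blast
  next
    assume "\<exists>\<sigma> \<tau> S T. (\<sigma>, \<tau>) \<in> PF_order k k \<and> (S, T) \<in> boolean_lattice (Suc d)
        \<and> x = extend_many k (Suc d) S \<sigma> \<and> y = extend_many k (Suc d) T \<tau>"
    then obtain \<sigma> \<tau> S T where \<sigma>: "(\<sigma>, \<tau>) \<in> PF_order k k" and ST: "S \<subseteq> T" "T \<subseteq> {1..Suc d}"
      and eq: "x = extend_many k (Suc d) S \<sigma>" "y = extend_many k (Suc d) T \<tau>"
      by (auto simp: boolean_lattice_def)
    have "(S \<inter> {1..d}, T \<inter> {1..d}) \<in> boolean_lattice d" using ST by (auto simp: boolean_lattice_def)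
    moreover have "extend_many k d S \<sigma> = extend_many k d (S \<inter> {1..d}) \<sigma>"
      "extend_many k d T \<tau> = extend_many k d (T \<inter> {1..d}) \<tau>"
      by (rule extend_many_cong, simp)+
    ultimately have "(extend_many k d S \<sigma>, extend_many k d T \<tau>) \<in> PF_order (k + d) k"
      using Suc.IH \<sigma> by blast
    moreover have "Suc d \<in> S \<longrightarrow> Suc d \<in> T" using ST by blast
    ultimately show "(x, y) \<in> PF_order (k + Suc d) k"
      using PF_order_Suc[of k "k + d" x y] eq by auto
  qed
qed

section \<open>Partial orders and the final isomorphism\<close>

lemma Partial_order_path_order:
  assumes "antisym (R\<^sup>*)"
  shows "Partial_order (path_order R a b)"
proof -
  have "refl_on (Field (path_order R a b)) (path_order R a b)"
    by (rule refl_onI) (auto simp: path_order_def Field_def intro: rtrancl_trans)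
  moreover have "trans (path_order R a b)"
    by (rule transI) (auto simp: path_order_def intro: rtrancl_trans)
  moreover have "antisym (path_order R a b)"
    using assms by (auto simp: path_order_def antisym_def)
  ultimately show ?thesis
    by (auto simp: partial_order_on_def preorder_on_def intro: FieldI1 FieldI2)
qed

lemma Partial_order_PF_order: "Partial_order (PF_order n k)"
  unfolding PF_order_def
proof (rule Partial_order_path_order)
  have "(PF_cover n k)\<^sup>* \<subseteq> (nc_cover (Suc n))\<^sup>*" by (rule rtrancl_mono) (auto simp: PF_cover_def)
  \<comment> \<open>A nontrivial path loses blocks, so no two distinct partitions can reach each
    other.\<close>
  then have *: "\<sigma> = \<tau> \<or> card \<tau> < card \<sigma>" if "(\<sigma>, \<tau>) \<in> (PF_cover n k)\<^sup>*" for \<sigma> \<tau>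
    using that rtrancl_nc_cover_card by blast
  show "antisym ((PF_cover n k)\<^sup>*)"
  proof (rule antisymI)
    fix \<sigma> \<tau>
    assume "(\<sigma>, \<tau>) \<in> (PF_cover n k)\<^sup>*" "(\<tau>, \<sigma>) \<in> (PF_cover n k)\<^sup>*"
    then show "\<sigma> = \<tau>" using *[of \<sigma> \<tau>] *[of \<tau> \<sigma>] by auto
  qed
qed

lemma Partial_order_boolean_lattice: "Partial_order (boolean_lattice m)"
  by (auto simp: boolean_lattice_def partial_order_on_def preorder_on_def refl_on_def Field_def
      trans_def antisym_def)

lemma Partial_order_poset_prod:
  assumes "Partial_order r" "Partial_order s"
  shows "Partial_order (poset_prod r s)"
proof -
  have "refl_on (Field r) r" "refl_on (Field s) s" "trans r" "trans s" "antisym r" "antisym s"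
    using assms by (auto simp: partial_order_on_def preorder_on_def)
  moreover from this(1,2) have "refl_on (Field (poset_prod r s)) (poset_prod r s)"
    by (auto simp: refl_on_def poset_prod_def Field_def)
  moreover from calculation(3,4) have "trans (poset_prod r s)"
    by (auto simp: poset_prod_def trans_def)
  moreover from calculation(5,6) have "antisym (poset_prod r s)"
    by (auto simp: poset_prod_def antisym_def)
  ultimately show ?thesis
    by (auto simp: partial_order_on_def preorder_on_def intro: FieldI1 FieldI2)
qed

text \<open>The map g runs from the product to the partitions, the direction in which extensions are
  built. With g injective, the single equation for r yields surjectivity and both directions of
  order preservation; the isomorphism is the inverse of g.\<close>

lemma poset_isomorphicI:
  assumes po: "Partial_order r" "Partial_order s"
    and inj: "inj_on g (Field s)" and r: "r = map_prod g g ` s"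
  shows "poset_isomorphic r s"
proof -
  have F: "Field r = g ` Field s" unfolding r Field_def by force
  let ?f = "the_inv_into (Field s) g"
  have "bij_betw ?f (Field r) (Field s)"
    unfolding F by (rule bij_betw_the_inv_into) (simp add: bij_betw_def inj)
  moreover have "(x, y) \<in> r \<longleftrightarrow> (?f x, ?f y) \<in> s" if xy: "x \<in> Field r" "y \<in> Field r" for x y
  proof -
    obtain u v where uv: "x = g u" "y = g v" "u \<in> Field s" "v \<in> Field s" using xy F by blast
    have "(g u, g v) \<in> r \<longleftrightarrow> (u, v) \<in> s"
    proof
      assume "(g u, g v) \<in> r"
      then obtain u' v' where "(u', v') \<in> s" "g u = g u'" "g v = g v'" unfolding r by auto
      then show "(u, v) \<in> s" using inj uv by (metis FieldI1 FieldI2 inj_onD)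
    qed (auto simp: r)
    then show ?thesis using uv the_inv_into_f_f[OF inj] by simp
  qed
  ultimately show ?thesis unfolding poset_isomorphic_def using po by blast
qed

theorem theorem2p5:
  fixes n k :: nat
  assumes "1 < k" and "k < n"
  shows "poset_isomorphic (Poset n (PF n k)) (poset_prod (Poset k (PF k k)) (boolean_lattice (n - k)))"
proof -
  define d where "d = n - k"
  have n: "n = k + d" using assms by (simp add: d_def)
  define g where "g = (\<lambda>(\<sigma>, S). extend_many k d S \<sigma>)"
  let ?s = "poset_prod (PF_order k k) (boolean_lattice d)"
  \<comment> \<open>The bound on S turns agreement of the sets on \<open>{1..d}\<close>, all that
    \<open>extend_many_inj\<close> yields, into equality.\<close>
  have field: "\<sigma> \<in> NC (Suc k) \<and> S \<subseteq> {1..d}" if "(\<sigma>, S) \<in> Field ?s" for \<sigma> S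
    using that PF_order_NC by (auto simp: Field_def poset_prod_def boolean_lattice_def)
  have "poset_isomorphic (PF_order (k + d) k) ?s"
  proof (rule poset_isomorphicI)
    show "inj_on g (Field ?s)"
    proof (rule inj_onI, clarify)
      fix \<sigma> S \<tau> T
      assume "(\<sigma>, S) \<in> Field ?s" "(\<tau>, T) \<in> Field ?s" "g (\<sigma>, S) = g (\<tau>, T)"
      then show "\<sigma> = \<tau> \<and> S = T"
        using field[of \<sigma> S] field[of \<tau> T] extend_many_inj[of \<sigma> k \<tau> d S T]
        by (simp add: g_def Int_absorb2)
    qed
    show "PF_order (k + d) k = map_prod g g ` ?s"
    proof (intro set_eqI iffI)
      fix p assume "p \<in> PF_order (k + d) k"
      then obtain \<sigma> \<tau> S T where "(\<sigma>, \<tau>) \<in> PF_order k k" "(S, T) \<in> boolean_lattice d"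
        "p = (extend_many k d S \<sigma>, extend_many k d T \<tau>)"
        using PF_order_extend_many[of "fst p" "snd p" k d] by (cases p) auto
      then have "((\<sigma>, S), (\<tau>, T)) \<in> ?s" "p = map_prod g g ((\<sigma>, S), (\<tau>, T))"
        by (auto simp: poset_prod_def g_def)
      then show "p \<in> map_prod g g ` ?s" by blast
    next
      fix p assume "p \<in> map_prod g g ` ?s"
      then obtain \<sigma> \<tau> S T where "(\<sigma>, \<tau>) \<in> PF_order k k" "(S, T) \<in> boolean_lattice d"
        and p: "p = (extend_many k d S \<sigma>, extend_many k d T \<tau>)"
        by (auto simp: poset_prod_def g_def)
      then show "p \<in> PF_order (k + d) k"
        unfolding p PF_order_extend_many by blast
    qed
  qed (intro Partial_order_poset_prod Partial_order_PF_order Partial_order_boolean_lattice)+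
  then show ?thesis
    using Poset_PF[of k n] Poset_PF[of k k] assms by (simp add: n)
qed

end
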